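(* Let $\mathbf{X}=(X,\omega_1,\omega_2,\mathbf{g})$ be a $2$-Kähler manifold and let $t\in\mathbb{R}$, $t>0$. Then $\alpha_t(\mathbf{X})$, $\beta_t(\mathbf{X})$ and $\lambda_t(\mathbf{X})$ are also $2$-Kähler.
   Context: A smooth manifold $X$ of dimension $3n$ with a Riemannian metric $\mathbf{g}$ and $2$-forms $\omega_1,\omega_2$ is $2$-Kähler if for each point $p$ there are an open neighborhood $\mathcal{U}$ of $p$ and coordinates $x_i,y_i^j$ ($i=1,\dots,n$, $j=1,2$) on $\mathcal{U}$ (centered at $p$) such that $\omega_j=\sum_idx_i\wedge dy_i^j$ for $j=1,2$, and $\mathbf{g}_{(\mathbf{x},\mathbf{y})}=\sum_idx_i\otimes dx_i+\sum_{i,j}dy_i^j\otimes dy_i^j+\mathbf{O}(2)$, where $\mathbf{O}(2)$ denotes terms vanishing to order two at $p$. In particular every $T_pX$ has an orthonormal standard polysymplectic basis, i.e. an orthonormal basis $v_1,\dots,v_n,w_1^1,\dots,w_n^1,w_1^2,\dots,w_n^2$ with $\omega_j=\sum_iv_i^*\wedge(w_i^j)^*$. Deformations, for $t>0$: $\alpha_t(\mathbf{X})=(X,t\omega_1,\omega_2,\alpha_t(\mathbf{g}))$, where $\alpha_t(\mathbf{g})$ is the metric for which any $\mathbf{g}$-orthonormal standard polysymplectic basis $v_1,\dots,v_n,w_1^1,\dots,w_n^2$ of $T_pX$ is orthogonal, with $v_i$ and $w_i^1$ of squared length $t$ and $w_i^2$ of squared length $t^{-1}$; $\beta_t(\mathbf{X})=(X,\omega_1,t\omega_2,\beta_t(\mathbf{g}))$,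 where $\beta_t(\mathbf{g})$ is defined in the same way with the upper indices $1$ and $2$ exchanged; $\lambda_t(\mathbf{X})=(X,t\omega_1,t\omega_2,t\mathbf{g})$. *)

theory Defs
  imports "HOL-Analysis.Analysis" "HOL-Library.Landau_Symbols"
begin

section \<open>Smooth manifolds, tangent spaces and tensors\<close>

(* C^k and smooth maps; only used for open S, so that "at x" is the right filter. *)
primrec Ck_on :: "nat \<Rightarrow> 'e::euclidean_space set \<Rightarrow> ('e \<Rightarrow> 'f::real_normed_vector) \<Rightarrow> bool" where
  "Ck_on 0 S f \<longleftrightarrow> continuous_on S f"
| "Ck_on (Suc k) S f \<longleftrightarrow>
     (\<forall>x\<in>S. f differentiable (at x)) \<and> (\<forall>v. Ck_on k S (\<lambda>x. frechet_derivative f (at x) v))"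

definition smooth_on :: "'e::euclidean_space set \<Rightarrow> ('e \<Rightarrow> 'f::real_normed_vector) \<Rightarrow> bool" where
  "smooth_on S f \<longleftrightarrow> (\<forall>k. Ck_on k S f)"

(* A chart is a pair (U, phi); the values of phi outside U are irrelevant. *)
type_synonym ('a, 'k) chart = "'a set \<times> ('a \<Rightarrow> real^'k)"

definition is_chart :: "'a topology \<Rightarrow> ('a, 'k::finite) chart \<Rightarrow> bool" where
  "is_chart M c \<longleftrightarrow>
     openin M (fst c) \<and> open (snd c ` fst c) \<and>
     homeomorphic_map (subtopology M (fst c)) (top_of_set (snd c ` fst c)) (snd c)"

definition chart_inv :: "('a, 'k::finite) chart \<Rightarrow> real^'k \<Rightarrow> 'a" where
  "chart_inv c = inv_into (fst c) (snd c)"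

definition transition :: "('a, 'k::finite) chart \<Rightarrow> ('a, 'k) chart \<Rightarrow> real^'k \<Rightarrow> real^'k" where
  "transition c d = snd d \<circ> chart_inv c"

definition compatible :: "('a, 'k::finite) chart \<Rightarrow> ('a, 'k) chart \<Rightarrow> bool" where
  "compatible c d \<longleftrightarrow>
     smooth_on (snd c ` (fst c \<inter> fst d)) (transition c d) \<and>
     smooth_on (snd d ` (fst c \<inter> fst d)) (transition d c)"

record ('a, 'k::finite) manifold =
  topol :: "'a topology"
  atlas :: "('a, 'k) chart set"

(* The atlas is required to be maximal, so its elements are exactly the smooth local
   coordinate systems; the dimension is CARD('k). *)
definition smooth_manifold :: "('a, 'k::finite, 'z) manifold_scheme \<Rightarrow> bool" where
  "smooth_manifold X \<longleftrightarrow>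
     Hausdorff_space (topol X) \<and> second_countable (topol X) \<and>
     (\<forall>c\<in>atlas X. is_chart (topol X) c) \<and>
     (\<Union>c\<in>atlas X. fst c) = topspace (topol X) \<and>
     (\<forall>c\<in>atlas X. \<forall>d\<in>atlas X. compatible c d) \<and>
     (\<forall>c. is_chart (topol X) c \<and> (\<forall>d\<in>atlas X. compatible c d) \<longrightarrow> c \<in> atlas X)"

definition charts_at :: "('a, 'k::finite, 'z) manifold_scheme \<Rightarrow> 'a \<Rightarrow> ('a, 'k) chart set" where
  "charts_at X p = {c \<in> atlas X. p \<in> fst c}"

(* A tangent vector at p assigns to each chart c around p its coordinate vector in c, these
   being related by the Jacobians of the transition maps. It is 0 on all other pairs, so that
   tangent vectors are equal as soon as they agree on the charts around p. *)
type_synonym ('a, 'k) tvec = "('a, 'k) chart \<Rightarrow> real^'k"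

definition tangent_space :: "('a, 'k::finite, 'z) manifold_scheme \<Rightarrow> 'a \<Rightarrow> ('a, 'k) tvec set" where
  "tangent_space X p =
     {u. (\<forall>c\<in>charts_at X p. \<forall>d\<in>charts_at X p.
            u d = frechet_derivative (transition c d) (at (snd c p)) (u c)) \<and>
         (\<forall>c. c \<notin> charts_at X p \<longrightarrow> u c = 0)}"

definition tadd :: "('a, 'k::finite) tvec \<Rightarrow> ('a, 'k) tvec \<Rightarrow> ('a, 'k) tvec" where
  "tadd u v = (\<lambda>c. u c + v c)"

definition tscale :: "real \<Rightarrow> ('a, 'k::finite) tvec \<Rightarrow> ('a, 'k) tvec" where
  "tscale r u = (\<lambda>c. r *\<^sub>R u c)"

definition tlincomb :: "('b::finite \<Rightarrow> real) \<Rightarrow> ('b \<Rightarrow> ('a, 'k::finite) tvec) \<Rightarrow> ('a, 'k) tvec" where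
  "tlincomb r b = (\<lambda>c. \<Sum>k\<in>UNIV. r k *\<^sub>R b k c)"

(* The coordinate vector field d/dz_k of the chart c, at p. *)
definition coord_vec ::
  "('a, 'k::finite, 'z) manifold_scheme \<Rightarrow> ('a, 'k) chart \<Rightarrow> 'k \<Rightarrow> 'a \<Rightarrow> ('a, 'k) tvec" where
  "coord_vec X c k p = (\<lambda>d. if d \<in> charts_at X p
     then frechet_derivative (transition c d) (at (snd c p)) (axis k 1) else 0)"

(* The coordinate 1-form dz_k of the chart c. *)
definition coord_form :: "('a, 'k::finite) chart \<Rightarrow> 'k \<Rightarrow> ('a, 'k) tvec \<Rightarrow> real" where
  "coord_form c k u = u c $ k"

definition wedge :: "('v \<Rightarrow> real) \<Rightarrow> ('v \<Rightarrow> real) \<Rightarrow> 'v \<Rightarrow> 'v \<Rightarrow> real" where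
  "wedge \<theta> \<eta> u v = \<theta> u * \<eta> v - \<theta> v * \<eta> u"

definition is_basis :: "('a, 'k::finite) tvec set \<Rightarrow> ('b::finite \<Rightarrow> ('a, 'k) tvec) \<Rightarrow> bool" where
  "is_basis T b \<longleftrightarrow> (\<forall>k. b k \<in> T) \<and> (\<forall>u\<in>T. \<exists>!r. u = tlincomb r b)"

definition dual_basis :: "('b::finite \<Rightarrow> ('a, 'k::finite) tvec) \<Rightarrow> 'b \<Rightarrow> ('a, 'k) tvec \<Rightarrow> real" where
  "dual_basis b k u = (THE r. u = tlincomb r b) k"

definition bilinear_on ::
  "('a, 'k::finite) tvec set \<Rightarrow> (('a, 'k) tvec \<Rightarrow> ('a, 'k) tvec \<Rightarrow> real) \<Rightarrow> bool" where
  "bilinear_on T B \<longleftrightarrow>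
     (\<forall>u\<in>T. \<forall>v\<in>T. \<forall>w\<in>T. B (tadd u v) w = B u w + B v w \<and> B w (tadd u v) = B w u + B w v) \<and>
     (\<forall>r. \<forall>u\<in>T. \<forall>v\<in>T. B (tscale r u) v = r * B u v \<and> B u (tscale r v) = r * B u v)"

definition inner_product_on ::
  "('a, 'k::finite) tvec set \<Rightarrow> (('a, 'k) tvec \<Rightarrow> ('a, 'k) tvec \<Rightarrow> real) \<Rightarrow> bool" where
  "inner_product_on T B \<longleftrightarrow>
     bilinear_on T B \<and> (\<forall>u\<in>T. \<forall>v\<in>T. B u v = B v u) \<and>
     (\<forall>u\<in>T. u \<noteq> (\<lambda>c. 0) \<longrightarrow> 0 < B u u)"

(* A field of bilinear forms is a function of a point p and two vectors; only its values at
   points of the manifold and on vectors of tangent_space X p are meaningful. *)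
type_synonym ('a, 'k) tensor2 = "'a \<Rightarrow> ('a, 'k) tvec \<Rightarrow> ('a, 'k) tvec \<Rightarrow> real"

definition tensor_component :: "('a, 'k::finite, 'z) manifold_scheme \<Rightarrow> ('a, 'k) tensor2 \<Rightarrow>
    ('a, 'k) chart \<Rightarrow> 'k \<Rightarrow> 'k \<Rightarrow> real^'k \<Rightarrow> real" where
  "tensor_component X \<tau> c k l z =
     (let q = chart_inv c z in \<tau> q (coord_vec X c k q) (coord_vec X c l q))"

definition smooth_tensor2 :: "('a, 'k::finite, 'z) manifold_scheme \<Rightarrow> ('a, 'k) tensor2 \<Rightarrow> bool" where
  "smooth_tensor2 X \<tau> \<longleftrightarrow>
     (\<forall>p\<in>topspace (topol X). bilinear_on (tangent_space X p) (\<tau> p)) \<and>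
     (\<forall>c\<in>atlas X. \<forall>k l. smooth_on (snd c ` fst c) (tensor_component X \<tau> c k l))"

definition two_form :: "('a, 'k::finite, 'z) manifold_scheme \<Rightarrow> ('a, 'k) tensor2 \<Rightarrow> bool" where
  "two_form X \<tau> \<longleftrightarrow>
     smooth_tensor2 X \<tau> \<and>
     (\<forall>p\<in>topspace (topol X). \<forall>u\<in>tangent_space X p. \<forall>v\<in>tangent_space X p. \<tau> p u v = - \<tau> p v u)"

definition riemannian_metric :: "('a, 'k::finite, 'z) manifold_scheme \<Rightarrow> ('a, 'k) tensor2 \<Rightarrow> bool" where
  "riemannian_metric X g \<longleftrightarrow>
     smooth_tensor2 X g \<and>
     (\<forall>p\<in>topspace (topol X). inner_product_on (tangent_space X p) (g p))"

section \<open>2-Kaehler manifolds\<close>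

(* Coordinates on R^(3n), n = CARD('n): Inl i indexes x_i (and v_i), while Inr (j, i)
   indexes y_i^j (and w_i^j). The upper index j ranges over the two-element type 2, whose
   elements are 1 and 2 (= 0). *)
type_synonym 'n idx = "'n + 2 \<times> 'n"

lemma CARD_idx: "CARD('n::finite idx) = 3 * CARD('n)"
  by simp

record ('a, 'n::finite) two_sympl = "('a, 'n idx) manifold" +
  form :: "2 \<Rightarrow> ('a, 'n idx) tensor2"
  gmet :: "('a, 'n idx) tensor2"

definition darboux_form :: "('a, 'n::finite idx) chart \<Rightarrow> 2 \<Rightarrow>
    ('a, 'n idx) tvec \<Rightarrow> ('a, 'n idx) tvec \<Rightarrow> real" where
  "darboux_form c j u v =
     (\<Sum>i\<in>UNIV. wedge (coord_form c (Inl i)) (coord_form c (Inr (j, i))) u v)"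

definition flat_metric :: "('a, 'n::finite idx) chart \<Rightarrow>
    ('a, 'n idx) tvec \<Rightarrow> ('a, 'n idx) tvec \<Rightarrow> real" where
  "flat_metric c u v =
     (\<Sum>i\<in>UNIV. coord_form c (Inl i) u * coord_form c (Inl i) v) +
     (\<Sum>i\<in>UNIV. \<Sum>j\<in>UNIV. coord_form c (Inr (j, i)) u * coord_form c (Inr (j, i)) v)"

(* The filter is nhds 0, not at 0, so the remainder is also required to vanish at 0. *)
definition two_kaehler :: "('a, 'n::finite) two_sympl \<Rightarrow> bool" where
  "two_kaehler X \<longleftrightarrow>
     smooth_manifold X \<and> riemannian_metric X (gmet X) \<and> (\<forall>j. two_form X (form X j)) \<and>
     (\<forall>p\<in>topspace (topol X). \<exists>c\<in>charts_at X p.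
        snd c p = 0 \<and>
        (\<forall>j. \<forall>q\<in>fst c. \<forall>u\<in>tangent_space X q. \<forall>v\<in>tangent_space X q.
           form X j q u v = darboux_form c j u v) \<and>
        (\<forall>k l. tensor_component X (\<lambda>q u v. gmet X q u v - flat_metric c u v) c k l
           \<in> O[nhds 0](\<lambda>z. (norm z)\<^sup>2)))"

definition standard_polysymplectic_basis :: "('a, 'n::finite) two_sympl \<Rightarrow> 'a \<Rightarrow>
    ('n idx \<Rightarrow> ('a, 'n idx) tvec) \<Rightarrow> bool" where
  "standard_polysymplectic_basis X p b \<longleftrightarrow>
     is_basis (tangent_space X p) b \<and>
     (\<forall>j. \<forall>u\<in>tangent_space X p. \<forall>v\<in>tangent_space X p.
        form X j p u v =
        (\<Sum>i\<in>UNIV. wedge (dual_basis b (Inl i)) (dual_basis b (Inr (j, i))) u v))"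

definition orthonormal :: "('v \<Rightarrow> 'v \<Rightarrow> real) \<Rightarrow> ('b \<Rightarrow> 'v) \<Rightarrow> bool" where
  "orthonormal B b \<longleftrightarrow> (\<forall>k l. B (b k) (b l) = (if k = l then 1 else 0))"

(* Squared lengths of the vectors of the basis in the metric deformed in the direction j:
   t for v_i and w_i^j, and 1/t for w_i^m with m \<noteq> j. *)
fun deformed_sqlen :: "2 \<Rightarrow> real \<Rightarrow> 'n idx \<Rightarrow> real" where
  "deformed_sqlen j t (Inl i) = t"
| "deformed_sqlen j t (Inr (m, i)) = (if m = j then t else inverse t)"

(* The vanishing outside the tangent space only makes the function B unique. *)
definition deformed_metric :: "2 \<Rightarrow> real \<Rightarrow> ('a, 'n::finite) two_sympl \<Rightarrow> ('a, 'n idx) tensor2" where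
  "deformed_metric j t X p =
     (THE B. inner_product_on (tangent_space X p) B \<and>
        (\<forall>u v. u \<notin> tangent_space X p \<or> v \<notin> tangent_space X p \<longrightarrow> B u v = 0) \<and>
        (\<forall>b. standard_polysymplectic_basis X p b \<and> orthonormal (gmet X p) b \<longrightarrow>
           (\<forall>k l. B (b k) (b l) = (if k = l then deformed_sqlen j t k else 0))))"

definition deform :: "2 \<Rightarrow> real \<Rightarrow> ('a, 'n::finite) two_sympl \<Rightarrow> ('a, 'n) two_sympl" where
  "deform j t X = X\<lparr>
     form := (\<lambda>m p u v. if m = j then t * form X m p u v else form X m p u v),
     gmet := deformed_metric j t X\<rparr>"

definition alpha_deform :: "real \<Rightarrow> ('a, 'n::finite) two_sympl \<Rightarrow> ('a, 'n) two_sympl" where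
  "alpha_deform t X = deform 1 t X"

definition beta_deform :: "real \<Rightarrow> ('a, 'n::finite) two_sympl \<Rightarrow> ('a, 'n) two_sympl" where
  "beta_deform t X = deform 2 t X"

definition lambda_deform :: "real \<Rightarrow> ('a, 'n::finite) two_sympl \<Rightarrow> ('a, 'n) two_sympl" where
  "lambda_deform t X = X\<lparr>
     form := (\<lambda>m p u v. t * form X m p u v),
     gmet := (\<lambda>p u v. t * gmet X p u v)\<rparr>"

end

theory Submission
  imports Defs
begin

text \<open>Let \<open>A\<close> be the endomorphism field with \<open>g(w, A u) = \<omega>\<^sub>j(w, u)\<close>. In an orthonormal standard
  polysymplectic basis, \<open>-A\<^sup>2\<close> is the orthogonal projection onto the span of the \<open>v\<^sub>i\<close> and \<open>w\<^sub>i\<^sup>j\<close>, so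
  the metric deformed in the direction \<open>j\<close> is \<open>t\<^sup>-\<^sup>1 g(u, v) + (t - t\<^sup>-\<^sup>1) \<omega>\<^sub>j(A u, v)\<close>. This shows that it
  does not depend on the basis and that it is smooth. In a Darboux chart in which \<open>g\<close> has the
  Gram matrix \<open>G = I + O(2)\<close>, the matrix \<open>\<Omega>\<close> of \<open>\<omega>\<^sub>j\<close> is constant and the matrix \<open>Y = G\<^sup>-\<^sup>1 \<Omega>\<close> of \<open>A\<close>
  satisfies \<open>Y - \<Omega> = (I - G) Y = O(2)\<close>. Hence the deformed metric is constant and diagonal up to
  \<open>O(2)\<close>, and rescaling the coordinates by the square roots of the diagonal entries gives the
  required chart.\<close>

section \<open>Smooth functions\<close>

text \<open>Derivatives at a point of an open set depend only on the values nearby, so equality on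
  \<open>S\<close> passes to all iterated derivatives.\<close>

lemma Ck_on_cong:
  assumes "open S" "\<And>x. x \<in> S \<Longrightarrow> f x = g x" "Ck_on k S f"
  shows "Ck_on k S g"
  using assms(2,3)
proof (induction k arbitrary: f g)
  case 0
  then show ?case using continuous_on_cong[of S S f g] by simp
next
  case (Suc k)
  have f: "(f has_derivative frechet_derivative f (at x)) (at x)" if "x \<in> S" for x
    using Suc.prems(2) that frechet_derivative_works by auto
  have D: "(g has_derivative frechet_derivative f (at x)) (at x)" if "x \<in> S" for x
    by (rule has_derivative_transform_within_open[OF f[OF that] assms(1) that Suc.prems(1)])
  have eq: "frechet_derivative f (at x) = frechet_derivative g (at x)" if "x \<in> S" for x
    by (rule frechet_derivative_at[OF D[OF that]])
  have "Ck_on k S (\<lambda>x. frechet_derivative g (at x) v)" for v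
    by (rule Suc.IH[of "\<lambda>x. frechet_derivative f (at x) v"])
      (use eq Suc.prems(2) in simp_all)
  with D show ?case unfolding Ck_on.simps differentiable_def by blast
qed

lemma Ck_on_SucD:
  assumes "Ck_on (Suc k) S f"
  shows "x \<in> S \<Longrightarrow> (f has_derivative frechet_derivative f (at x)) (at x)"
    "Ck_on k S (\<lambda>x. frechet_derivative f (at x) v)"
  using assms frechet_derivative_works by auto

lemma Ck_on_Suc_imp: "Ck_on (Suc k) S f \<Longrightarrow> Ck_on k S f"
proof (induction k arbitrary: f)
  case 0
  then show ?case
    by (auto intro!: differentiable_imp_continuous_on differentiable_at_imp_differentiable_on)
next
  case (Suc k)
  show ?case
    unfolding Ck_on.simps(2)[of k]
    using Suc.IH[OF Ck_on_SucD(2)[OF Suc.prems]] Suc.prems[unfolded Ck_on.simps(2)[of "Suc k"]] by blast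
qed

text \<open>Allows an explicit derivative \<open>f'\<close> in place of
  \<open>frechet_derivative\<close>. The two agree only on \<open>S\<close>, hence the congruence
  above.\<close>

lemma Ck_on_SucI:
  assumes "open S" "\<And>x. x \<in> S \<Longrightarrow> (f has_derivative f' x) (at x)"
    "\<And>v. Ck_on k S (\<lambda>x. f' x v)"
  shows "Ck_on (Suc k) S f"
proof -
  have "frechet_derivative f (at x) = f' x" if "x \<in> S" for x
    using frechet_derivative_at[OF assms(2)[OF that]] by simp
  then have "Ck_on k S (\<lambda>x. frechet_derivative f (at x) v)" for v
    by (intro Ck_on_cong[OF assms(1) _ assms(3)[of v]]) simp
  with assms(2) show ?thesis unfolding Ck_on.simps differentiable_def by blast
qed

lemma Ck_on_const: "open S \<Longrightarrow> Ck_on k S (\<lambda>x. a)"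
proof (induction k arbitrary: a)
  case (Suc k)
  show ?case using Suc by (intro Ck_on_SucI[where f' = "\<lambda>x v. 0"]) auto
qed simp

lemma Ck_on_add:
  "open S \<Longrightarrow> Ck_on k S f \<Longrightarrow> Ck_on k S g \<Longrightarrow> Ck_on k S (\<lambda>x. f x + g x)"
proof (induction k arbitrary: f g)
  case (Suc k)
  note D = Ck_on_SucD[OF Suc.prems(2)] Ck_on_SucD[OF Suc.prems(3)]
  show ?case
    by (rule Ck_on_SucI[OF Suc.prems(1) has_derivative_add[OF D(1) D(3)]], assumption, assumption)
      (rule Suc.IH[OF Suc.prems(1) D(2) D(4)])
qed (simp add: continuous_on_add)

lemma Ck_on_mult:
  fixes f g :: "'e::euclidean_space \<Rightarrow> real"
  shows "open S \<Longrightarrow> Ck_on k S f \<Longrightarrow> Ck_on k S g \<Longrightarrow> Ck_on k S (\<lambda>x. f x * g x)"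
proof (induction k arbitrary: f g)
  case (Suc k)
  note D = Ck_on_SucD[OF Suc.prems(2)] Ck_on_SucD[OF Suc.prems(3)]
  note I = Suc.IH[OF Suc.prems(1)]
  show ?case
    by (rule Ck_on_SucI[OF Suc.prems(1) has_derivative_mult[OF D(1) D(3)]], assumption, assumption)
      (rule Ck_on_add[OF Suc.prems(1) I[OF Ck_on_Suc_imp[OF Suc.prems(2)] D(4)]
          I[OF D(2) Ck_on_Suc_imp[OF Suc.prems(3)]]])
qed (simp add: continuous_on_mult)

text \<open>The derivative of 1/f is a product of 1/f, f' and 1/f, so one order of smoothness of f
  yields one order for 1/f by induction.\<close>

lemma Ck_on_inverse:
  fixes f :: "'e::euclidean_space \<Rightarrow> real"
  assumes "open S" "\<And>x. x \<in> S \<Longrightarrow> f x \<noteq> 0"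
  shows "Ck_on k S f \<Longrightarrow> Ck_on k S (\<lambda>x. inverse (f x))"
proof (induction k)
  case 0
  then show ?case using assms by (auto intro: continuous_on_inverse)
next
  case (Suc k)
  note D = Ck_on_SucD[OF Suc.prems]
  have I: "Ck_on k S (\<lambda>x. inverse (f x))"
    using Suc.IH Suc.prems Ck_on_Suc_imp by blast
  show ?case
  proof (rule Ck_on_SucI[OF assms(1)])
    \<comment> \<open>The sign is written as a constant factor so that the product rule alone covers
      the expression.\<close>
    show "((\<lambda>x. inverse (f x)) has_derivative
        (\<lambda>v. (-1) * (inverse (f x) * frechet_derivative f (at x) v * inverse (f x)))) (at x)"
      if "x \<in> S" for x
      using Deriv.has_derivative_inverse[OF assms(2)[OF that] D(1)[OF that]] by simp
    show "Ck_on k S (\<lambda>x. (-1) * (inverse (f x) * frechet_derivative f (at x) v * inverse (f x)))" for v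
      by (intro Ck_on_mult Ck_on_const I D assms(1))
  qed
qed

lemma Ck_on_linear_comp_left:
  assumes "open S" "bounded_linear L"
  shows "Ck_on k S f \<Longrightarrow> Ck_on k S (\<lambda>x. L (f x))"
proof (induction k arbitrary: f)
  case 0
  then show ?case using assms by (simp add: bounded_linear.continuous_on)
next
  case (Suc k)
  show ?case
    by (rule Ck_on_SucI[OF assms(1) bounded_linear.has_derivative[OF assms(2) Ck_on_SucD(1)[OF Suc.prems]]], assumption)
      (rule Suc.IH[OF Ck_on_SucD(2)[OF Suc.prems]])
qed

text \<open>By the chain rule the derivative in direction \<open>v\<close> is the derivative of
  \<open>f\<close> in the fixed direction \<open>L v\<close>, again composed with \<open>L\<close>;
  the induction hypothesis applies to it.\<close>

lemma Ck_on_linear_comp_right: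
  assumes "open S" "open S'" "bounded_linear L" "L ` S' \<subseteq> S"
  shows "Ck_on k S f \<Longrightarrow> Ck_on k S' (\<lambda>x. f (L x))"
proof (induction k arbitrary: f)
  case 0
  then show ?case
    using continuous_on_compose2[of S f S' L] linear_continuous_on[OF assms(3)] assms(4) by simp
next
  case (Suc k)
  show ?case
  proof (rule Ck_on_SucI[OF assms(2)])
    show "((\<lambda>x. f (L x)) has_derivative (\<lambda>v. frechet_derivative f (at (L x)) (L v))) (at x)"
      if "x \<in> S'" for x
      by (rule has_derivative_compose[OF bounded_linear_imp_has_derivative[OF assms(3)]])
        (use that assms(4) Ck_on_SucD(1)[OF Suc.prems] in blast)
    show "Ck_on k S' (\<lambda>x. frechet_derivative f (at (L x)) (L v))" for v
      by (rule Suc.IH[OF Ck_on_SucD(2)[OF Suc.prems]])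
  qed
qed

section \<open>Closure properties of smooth functions\<close>

lemma smooth_on_cong:
  "open S \<Longrightarrow> (\<And>x. x \<in> S \<Longrightarrow> f x = g x) \<Longrightarrow> smooth_on S f \<Longrightarrow> smooth_on S g"
  unfolding smooth_on_def using Ck_on_cong by blast

lemma smooth_on_const: "open S \<Longrightarrow> smooth_on S (\<lambda>x. a)"
  by (simp add: smooth_on_def Ck_on_const)

lemma smooth_on_add:
  "open S \<Longrightarrow> smooth_on S f \<Longrightarrow> smooth_on S g \<Longrightarrow> smooth_on S (\<lambda>x. f x + g x)"
  by (simp add: smooth_on_def Ck_on_add)

lemma smooth_on_mult:
  fixes f g :: "'e::euclidean_space \<Rightarrow> real"
  shows "open S \<Longrightarrow> smooth_on S f \<Longrightarrow> smooth_on S g \<Longrightarrow> smooth_on S (\<lambda>x. f x * g x)"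
  by (simp add: smooth_on_def Ck_on_mult)

lemma smooth_on_divide:
  fixes f g :: "'e::euclidean_space \<Rightarrow> real"
  assumes "open S" "smooth_on S f" "smooth_on S g" "\<And>x. x \<in> S \<Longrightarrow> g x \<noteq> 0"
  shows "smooth_on S (\<lambda>x. f x / g x)"
  unfolding divide_inverse using assms by (simp add: smooth_on_def Ck_on_mult Ck_on_inverse)

lemma smooth_on_sum:
  "open S \<Longrightarrow> (\<And>i. i \<in> I \<Longrightarrow> smooth_on S (f i)) \<Longrightarrow> smooth_on S (\<lambda>x. \<Sum>i\<in>I. f i x)"
  by (induction I rule: infinite_finite_induct) (auto intro: smooth_on_const smooth_on_add)

lemma smooth_on_prod:
  fixes f :: "'i \<Rightarrow> 'e::euclidean_space \<Rightarrow> real"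
  shows "open S \<Longrightarrow> (\<And>i. i \<in> I \<Longrightarrow> smooth_on S (f i)) \<Longrightarrow> smooth_on S (\<lambda>x. \<Prod>i\<in>I. f i x)"
  by (induction I rule: infinite_finite_induct) (auto intro: smooth_on_const smooth_on_mult)

text \<open>The Leibniz formula makes the determinant a polynomial in the entries.\<close>

lemma smooth_on_det:
  fixes A :: "'e::euclidean_space \<Rightarrow> real^'k^'k"
  assumes "open S" "\<And>i j. smooth_on S (\<lambda>x. A x $ i $ j)"
  shows "smooth_on S (\<lambda>x. det (A x))"
  unfolding det_def using assms
  by (intro smooth_on_sum smooth_on_mult smooth_on_const smooth_on_prod) auto

lemma smooth_on_imp_has_derivative:
  "smooth_on S f \<Longrightarrow> x \<in> S \<Longrightarrow> (f has_derivative frechet_derivative f (at x)) (at x)"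
  unfolding smooth_on_def by (rule Ck_on_SucD(1)[of 0]) blast

lemma smooth_on_imp_continuous_on: "smooth_on S f \<Longrightarrow> continuous_on S f"
  unfolding smooth_on_def by (metis Ck_on.simps(1))

section \<open>Charts and tangent spaces\<close>

lemma is_chart_inj_on: "is_chart M c \<Longrightarrow> inj_on (snd c) (fst c)"
  using openin_subset[of M "fst c"]
  by (auto simp: is_chart_def homeomorphic_map_def topspace_subtopology Int_absorb1)

text \<open>A chart is an open map onto its image, and that image is itself open in Euclidean
  space.\<close>

lemma is_chart_open_image:
  assumes "is_chart M c" "openin M V" "V \<subseteq> fst c"
  shows "open (snd c ` V)"
proof -
  have "openin (subtopology M (fst c)) V"
    using assms(2,3) openin_subset_topspace_eq openin_subtopology by blast
  moreover have "open_map (subtopology M (fst c)) (top_of_set (snd c ` fst c)) (snd c)"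
    using assms(1) homeomorphic_imp_open_map by (auto simp: is_chart_def)
  ultimately have "openin (top_of_set (snd c ` fst c)) (snd c ` V)"
    by (simp add: open_map_def)
  then show ?thesis
    using assms(1) openin_open_trans by (auto simp: is_chart_def)
qed

lemma chart_inv_chart: "is_chart M c \<Longrightarrow> q \<in> fst c \<Longrightarrow> chart_inv c (snd c q) = q"
  by (simp add: chart_inv_def is_chart_inj_on inv_into_f_f)

lemma chart_chart_inv: "z \<in> snd c ` V \<Longrightarrow> V \<subseteq> fst c \<Longrightarrow> snd c (chart_inv c z) = z"
  unfolding chart_inv_def by (rule f_inv_into_f) blast

lemma chart_inv_in:
  assumes "is_chart M c" "z \<in> snd c ` V" "V \<subseteq> fst c"
  shows "chart_inv c z \<in> V"
  using assms chart_inv_chart[OF assms(1)] by auto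

lemma bilinear_onD:
  assumes "bilinear_on T B" "u \<in> T" "v \<in> T"
  shows "w \<in> T \<Longrightarrow> B (tadd u w) v = B u v + B w v"
    and "w \<in> T \<Longrightarrow> B v (tadd u w) = B v u + B v w"
    and "B (tscale r u) v = r * B u v"
    and "B v (tscale r u) = r * B v u"
  using assms by (simp_all add: bilinear_on_def)

context
  fixes X :: "('a, 'k::finite, 'z) manifold_scheme"
  assumes sm: "smooth_manifold X"
begin

lemma atlas_is_chart: "c \<in> atlas X \<Longrightarrow> is_chart (topol X) c"
  using sm by (simp add: smooth_manifold_def)

lemma charts_atD:
  assumes "c \<in> charts_at X p"
  shows "c \<in> atlas X" "is_chart (topol X) c" "p \<in> fst c" "snd c p \<in> snd c ` fst c"
    "openin (topol X) (fst c)" "open (snd c ` fst c)"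
proof -
  show c: "c \<in> atlas X" and p: "p \<in> fst c"
    using assms by (simp_all add: charts_at_def)
  from p show "snd c p \<in> snd c ` fst c" by simp
  show "is_chart (topol X) c" by (rule atlas_is_chart[OF c])
  then show "openin (topol X) (fst c)" "open (snd c ` fst c)" by (simp_all add: is_chart_def)
qed

lemma charts_at_in_topspace: "c \<in> charts_at X p \<Longrightarrow> p \<in> topspace (topol X)"
  using charts_atD(3,5) openin_subset by blast

lemma charts_at_chart_inv:
  "c \<in> atlas X \<Longrightarrow> z \<in> snd c ` fst c \<Longrightarrow> c \<in> charts_at X (chart_inv c z)"
  using chart_inv_in[OF atlas_is_chart] by (auto simp: charts_at_def)

lemma open_chart_overlap:
  assumes "c \<in> atlas X" "d \<in> atlas X"
  shows "open (snd c ` (fst c \<inter> fst d))"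
  using assms[THEN atlas_is_chart]
  by (intro is_chart_open_image[of "topol X" c]) (simp_all add: is_chart_def openin_Int)

section \<open>Transition maps and their Jacobians\<close>

lemma transition_has_derivative:
  assumes "c \<in> charts_at X p" "d \<in> charts_at X p"
  shows "(transition c d has_derivative frechet_derivative (transition c d) (at (snd c p))) (at (snd c p))"
proof (rule smooth_on_imp_has_derivative)
  show "smooth_on (snd c ` (fst c \<inter> fst d)) (transition c d)"
    using assms sm by (simp add: smooth_manifold_def compatible_def charts_at_def)
qed (use assms in \<open>auto simp: charts_at_def\<close>)

lemma transition_chart:
  "c \<in> charts_at X p \<Longrightarrow> transition c d (snd c p) = snd d p"
  by (simp add: transition_def chart_inv_chart[OF charts_atD(2)] charts_atD(3))

lemma transition_self_has_derivative:
  assumes "c \<in> charts_at X p"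
  shows "(transition c c has_derivative (\<lambda>v. v)) (at (snd c p))"
  by (rule has_derivative_transform_within_open[OF has_derivative_ident charts_atD(6)[OF assms]
        charts_atD(4)[OF assms]])
    (simp add: transition_def chart_chart_inv)

lemma transition_self_derivative:
  "c \<in> charts_at X p \<Longrightarrow> frechet_derivative (transition c c) (at (snd c p)) v = v"
  using frechet_derivative_at[OF transition_self_has_derivative] by metis

text \<open>The chain rule. The composite of the two transitions agrees with the direct one only on
  the image of the overlap of \<open>c\<close> and \<open>d\<close>, which is an open neighbourhood
  of \<open>snd c p\<close>.\<close>

lemma transition_cocycle:
  assumes "c \<in> charts_at X p" "d \<in> charts_at X p" "e \<in> charts_at X p"
  shows "frechet_derivative (transition c e) (at (snd c p)) v =
    frechet_derivative (transition d e) (at (snd d p)) (frechet_derivative (transition c d) (at (snd c p)) v)"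
proof -
  let ?S = "snd c ` (fst c \<inter> fst d)"
  have "((\<lambda>z. transition d e (transition c d z)) has_derivative
      (\<lambda>v. frechet_derivative (transition d e) (at (snd d p)) (frechet_derivative (transition c d) (at (snd c p)) v)))
      (at (snd c p))"
    by (rule has_derivative_compose[OF transition_has_derivative[OF assms(1,2)]])
      (simp add: transition_chart[OF assms(1)] transition_has_derivative[OF assms(2,3)])
  moreover have "open ?S" "snd c p \<in> ?S"
    using assms open_chart_overlap charts_atD by auto
  moreover have "transition d e (transition c d z) = transition c e z" if "z \<in> ?S" for z
    using chart_inv_in[OF charts_atD(2)[OF assms(1)] that]
    by (simp add: transition_def chart_inv_chart[OF charts_atD(2)[OF assms(2)]])
  ultimately have "(transition c e has_derivative
      (\<lambda>v. frechet_derivative (transition d e) (at (snd d p)) (frechet_derivative (transition c d) (at (snd c p)) v)))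
      (at (snd c p))"
    by (rule has_derivative_transform_within_open)
  from frechet_derivative_at[OF this] show ?thesis by metis
qed

lemma linear_transition_derivative:
  "c \<in> charts_at X p \<Longrightarrow> d \<in> charts_at X p \<Longrightarrow>
    linear (frechet_derivative (transition c d) (at (snd c p)))"
  using transition_has_derivative has_derivative_linear by blast

section \<open>Tangent spaces as vector spaces\<close>

lemma tangent_spaceD:
  assumes "u \<in> tangent_space X p"
  shows "c \<in> charts_at X p \<Longrightarrow> d \<in> charts_at X p \<Longrightarrow>
      u d = frechet_derivative (transition c d) (at (snd c p)) (u c)"
    and "c \<notin> charts_at X p \<Longrightarrow> u c = 0"
  using assms unfolding tangent_space_def by blast+

lemma tangent_spaceI:
  assumes "\<And>c d. c \<in> charts_at X p \<Longrightarrow> d \<in> charts_at X p \<Longrightarrow>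
      frechet_derivative (transition c d) (at (snd c p)) (u c) = u d"
    and "\<And>c. c \<notin> charts_at X p \<Longrightarrow> u c = 0"
  shows "u \<in> tangent_space X p"
  using assms unfolding tangent_space_def by simp

lemma tlincomb_in_tangent_space:
  assumes "\<And>k. b k \<in> tangent_space X p"
  shows "tlincomb r b \<in> tangent_space X p"
proof (rule tangent_spaceI)
  fix c d assume cd: "c \<in> charts_at X p" "d \<in> charts_at X p"
  note F = linear_transition_derivative[OF cd]
  show "frechet_derivative (transition c d) (at (snd c p)) (tlincomb r b c) = tlincomb r b d"
    unfolding tlincomb_def linear_sum[OF F] linear_cmul[OF F]
    by (simp only: tangent_spaceD(1)[OF assms cd, symmetric])
qed (simp add: tlincomb_def tangent_spaceD(2)[OF assms])

lemma tadd_in_tangent_space: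
  assumes "u \<in> tangent_space X p" "v \<in> tangent_space X p"
  shows "tadd u v \<in> tangent_space X p"
proof (rule tangent_spaceI)
  fix c d assume cd: "c \<in> charts_at X p" "d \<in> charts_at X p"
  show "frechet_derivative (transition c d) (at (snd c p)) (tadd u v c) = tadd u v d"
    unfolding tadd_def linear_add[OF linear_transition_derivative[OF cd]]
    by (simp only: assms[THEN tangent_spaceD(1), OF cd, symmetric])
qed (simp add: tadd_def assms[THEN tangent_spaceD(2)])

lemma tscale_in_tangent_space:
  assumes "u \<in> tangent_space X p"
  shows "tscale r u \<in> tangent_space X p"
proof (rule tangent_spaceI)
  fix c d assume cd: "c \<in> charts_at X p" "d \<in> charts_at X p"
  show "frechet_derivative (transition c d) (at (snd c p)) (tscale r u c) = tscale r u d"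
    unfolding tscale_def linear_cmul[OF linear_transition_derivative[OF cd]]
    by (simp only: tangent_spaceD(1)[OF assms cd, symmetric])
qed (simp add: tscale_def assms[THEN tangent_spaceD(2)])

section \<open>Coordinate vectors as a basis\<close>

lemma coord_vec_in_tangent_space:
  assumes "c \<in> charts_at X p"
  shows "coord_vec X c k p \<in> tangent_space X p"
proof (rule tangent_spaceI)
  fix d e assume de: "d \<in> charts_at X p" "e \<in> charts_at X p"
  \<comment> \<open>The compatibility required of a tangent vector is here the cocycle rule for the
    charts \<open>c\<close>, \<open>d\<close>, \<open>e\<close>.\<close>
  show "frechet_derivative (transition d e) (at (snd d p)) (coord_vec X c k p d) = coord_vec X c k p e"
    using transition_cocycle[OF assms de] de by (simp add: coord_vec_def)
qed (simp add: coord_vec_def)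

lemma coord_vec_chart: "c \<in> charts_at X p \<Longrightarrow> coord_vec X c k p c = axis k 1"
  by (simp add: coord_vec_def transition_self_derivative)

text \<open>One chart determines the components in every other chart through the Jacobians; away
  from the charts around \<open>p\<close> both vectors are 0 by convention.\<close>

lemma tangent_vectors_eqI:
  assumes "c \<in> charts_at X p" "u \<in> tangent_space X p" "v \<in> tangent_space X p" "u c = v c"
  shows "u = v"
proof
  fix d
  show "u d = v d"
    using assms(2,3)[THEN tangent_spaceD(1), OF assms(1), of d] assms(2,3)[THEN tangent_spaceD(2), of d]
      assms(4) by metis
qed

lemma tlincomb_coord_vec:
  assumes "c \<in> charts_at X p"
  shows "tlincomb r (\<lambda>k. coord_vec X c k p) c = (\<chi> k. r k)"
proof -
  have "(\<Sum>k\<in>UNIV. r k *\<^sub>R axis k (1::real)) $ i = (\<Sum>k\<in>UNIV. if i = k then r k else 0)" for i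
    unfolding sum_component by (rule sum.cong) (auto simp: axis_def)
  then show ?thesis
    by (simp add: tlincomb_def coord_vec_chart[OF assms] vec_eq_iff)
qed

text \<open>Existence and uniqueness of coefficients in one equivalence: it yields both the basis
  property and the dual basis of the coordinate vectors.\<close>

lemma tangent_vector_eq_tlincomb_iff:
  assumes "c \<in> charts_at X p" "u \<in> tangent_space X p"
  shows "u = tlincomb r (\<lambda>k. coord_vec X c k p) \<longleftrightarrow> r = (\<lambda>k. u c $ k)"
proof
  assume "u = tlincomb r (\<lambda>k. coord_vec X c k p)"
  then have "u c = (\<chi> k. r k)" using tlincomb_coord_vec[OF assms(1)] by simp
  then show "r = (\<lambda>k. u c $ k)" by simp
next
  assume "r = (\<lambda>k. u c $ k)"
  then show "u = tlincomb r (\<lambda>k. coord_vec X c k p)"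
    by (intro tangent_vectors_eqI[OF assms] tlincomb_in_tangent_space
        coord_vec_in_tangent_space[OF assms(1)]) (simp add: tlincomb_coord_vec[OF assms(1)])
qed

lemma is_basis_coord_vec:
  "c \<in> charts_at X p \<Longrightarrow> is_basis (tangent_space X p) (\<lambda>k. coord_vec X c k p)"
  by (simp add: is_basis_def coord_vec_in_tangent_space tangent_vector_eq_tlincomb_iff)

lemma dual_basis_coord_vec:
  "c \<in> charts_at X p \<Longrightarrow> u \<in> tangent_space X p \<Longrightarrow>
    dual_basis (\<lambda>k. coord_vec X c k p) k u = u c $ k"
  by (simp add: dual_basis_def tangent_vector_eq_tlincomb_iff)

section \<open>Dual bases and the expansion of bilinear forms\<close>

lemma tlincomb_dual_basis:
  assumes "is_basis (tangent_space X p) b" "u \<in> tangent_space X p"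
  shows "tlincomb (\<lambda>k. dual_basis b k u) b = u"
  using assms theI'[of "\<lambda>r. u = tlincomb r b"] by (auto simp: is_basis_def dual_basis_def)

lemma dual_basis_tlincomb:
  assumes "is_basis (tangent_space X p) b"
  shows "dual_basis b k (tlincomb r b) = r k"
proof -
  have "tlincomb r b \<in> tangent_space X p"
    using assms by (auto simp: is_basis_def intro: tlincomb_in_tangent_space)
  then have "(THE s. tlincomb r b = tlincomb s b) = r"
    using assms by (intro the1_equality) (auto simp: is_basis_def)
  then show ?thesis by (simp add: dual_basis_def)
qed

lemma dual_basis_self:
  assumes "is_basis (tangent_space X p) b"
  shows "dual_basis b k (b l) = (if k = l then 1 else 0)"
proof -
  have "b l = tlincomb (\<lambda>k. if k = l then 1 else 0) b"
  proof
    fix c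
    have "tlincomb (\<lambda>k. if k = l then 1 else 0) b c = (\<Sum>k\<in>UNIV. if k = l then b k c else 0)"
      unfolding tlincomb_def by (rule sum.cong) auto
    then show "b l c = tlincomb (\<lambda>k. if k = l then 1 else 0) b c" by simp
  qed
  then have "dual_basis b k (b l) = dual_basis b k (tlincomb (\<lambda>k. if k = l then 1 else 0) b)"
    by (rule arg_cong)
  then show ?thesis by (simp only: dual_basis_tlincomb[OF assms])
qed

lemma bilinear_on_tlincomb:
  assumes B: "bilinear_on (tangent_space X p) B"
    and b: "\<And>k. b k \<in> tangent_space X p" and v: "v \<in> tangent_space X p"
  shows "B (tlincomb r b) v = (\<Sum>k\<in>UNIV. r k * B (b k) v)"
    and "B v (tlincomb r b) = (\<Sum>k\<in>UNIV. r k * B v (b k))"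
proof -
  \<comment> \<open>Partial sums over index sets. Their membership in the tangent space is part of
    the induction, since \<open>B\<close> is bilinear only there; the empty sum is written as
    \<open>tscale 0 v\<close> so that homogeneity makes \<open>B\<close> vanish on it.\<close>
  define L where "L A = (\<lambda>c. \<Sum>k\<in>A. r k *\<^sub>R b k c)" for A
  have zero: "L {} = tscale 0 v" by (simp add: L_def tscale_def)
  have ins: "L (insert k A) = tadd (tscale (r k) (b k)) (L A)" if "k \<notin> A" for k A
    using that by (simp add: L_def tadd_def tscale_def finite_subset[OF subset_UNIV])
  have "L A \<in> tangent_space X p \<and> B (L A) v = (\<Sum>k\<in>A. r k * B (b k) v)
      \<and> B v (L A) = (\<Sum>k\<in>A. r k * B v (b k))" for A
  proof (induction A rule: infinite_finite_induct)
    case (insert k A)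
    have kT: "tscale (r k) (b k) \<in> tangent_space X p" by (rule tscale_in_tangent_space[OF b])
    show ?case
      using insert ins[of k A] tadd_in_tangent_space[OF kT, of "L A"]
        bilinear_onD(1,2)[OF B kT v, of "L A"] bilinear_onD(3,4)[OF B b v, of "r k" k]
      by simp
  qed (use zero bilinear_onD(3,4)[OF B v v, of 0] tscale_in_tangent_space[OF v, of 0] in simp_all)
  from this[of UNIV] show "B (tlincomb r b) v = (\<Sum>k\<in>UNIV. r k * B (b k) v)"
    "B v (tlincomb r b) = (\<Sum>k\<in>UNIV. r k * B v (b k))"
    by (simp_all add: L_def tlincomb_def)
qed

lemma bilinear_on_expand:
  assumes B: "bilinear_on (tangent_space X p) B" and b: "is_basis (tangent_space X p) b"
    and u: "u \<in> tangent_space X p" and v: "v \<in> tangent_space X p"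
  shows "B u v = (\<Sum>k\<in>UNIV. \<Sum>l\<in>UNIV. dual_basis b k u * dual_basis b l v * B (b k) (b l))"
proof -
  have bT: "\<And>k. b k \<in> tangent_space X p" using b by (simp add: is_basis_def)
  have "B u v = B (tlincomb (\<lambda>k. dual_basis b k u) b) (tlincomb (\<lambda>k. dual_basis b k v) b)"
    using tlincomb_dual_basis[OF b] u v by simp
  then show ?thesis
    by (subst sum.swap)
      (simp add: bilinear_on_tlincomb[OF B bT] bT tlincomb_in_tangent_space[OF bT]
        sum_distrib_left mult_ac)
qed

end

section \<open>The deformed metric on a tangent space\<close>

lemma inner_product_on_imp_bilinear_on: "inner_product_on T B \<Longrightarrow> bilinear_on T B"
  by (simp add: inner_product_on_def)

text \<open>The candidate for the deformed metric in a given basis. It is 0 outside \<open>T\<close>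
  to match the normalisation in \<open>deformed_metric\<close>.\<close>

definition diagonal_form ::
  "('a, 'k::finite) tvec set \<Rightarrow> ('b::finite \<Rightarrow> ('a, 'k) tvec) \<Rightarrow> ('b \<Rightarrow> real) \<Rightarrow>
    ('a, 'k) tvec \<Rightarrow> ('a, 'k) tvec \<Rightarrow> real" where
  "diagonal_form T b \<sigma> u v =
    (if u \<in> T \<and> v \<in> T then \<Sum>k\<in>UNIV. \<sigma> k * dual_basis b k u * dual_basis b k v else 0)"

context
  fixes X :: "('a, 'k::finite, 'z) manifold_scheme" and p b
  assumes sm: "smooth_manifold X" and b: "is_basis (tangent_space X p) b"
begin

lemma basis_in_tangent_space: "b k \<in> tangent_space X p"
  using b by (simp add: is_basis_def)

lemma dual_basis_tadd:
  assumes "u \<in> tangent_space X p" "v \<in> tangent_space X p"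
  shows "dual_basis b k (tadd u v) = dual_basis b k u + dual_basis b k v"
proof -
  have "tadd (tlincomb r b) (tlincomb s b) = tlincomb (\<lambda>k. r k + s k) b" for r s
    by (simp add: tadd_def tlincomb_def scaleR_add_left sum.distrib)
  from this[of "\<lambda>k. dual_basis b k u" "\<lambda>k. dual_basis b k v"]
  have "tadd u v = tlincomb (\<lambda>k. dual_basis b k u + dual_basis b k v) b"
    using assms[THEN tlincomb_dual_basis[OF sm b]] by simp
  then show ?thesis using dual_basis_tlincomb[OF sm b] by simp
qed

lemma dual_basis_tscale:
  assumes "u \<in> tangent_space X p"
  shows "dual_basis b k (tscale r u) = r * dual_basis b k u"
proof -
  have "tscale r (tlincomb s b) = tlincomb (\<lambda>k. r * s k) b" for s
    by (simp add: tscale_def tlincomb_def scaleR_sum_right)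
  from this[of "\<lambda>k. dual_basis b k u"]
  have "tscale r u = tlincomb (\<lambda>k. r * dual_basis b k u) b"
    using assms[THEN tlincomb_dual_basis[OF sm b]] by simp
  then show ?thesis using dual_basis_tlincomb[OF sm b] by simp
qed

lemma inner_product_on_diagonal_form:
  assumes "\<And>k. 0 < \<sigma> k"
  shows "inner_product_on (tangent_space X p) (diagonal_form (tangent_space X p) b \<sigma>)"
  unfolding inner_product_on_def bilinear_on_def
proof (intro conjI ballI allI impI)
  fix u assume u: "u \<in> tangent_space X p" "u \<noteq> (\<lambda>c. 0)"
  \<comment> \<open>Coordinates determine the vector, so a nonzero vector has a nonzero coordinate,
    which makes the weighted sum of squares positive.\<close>
  obtain k where k: "dual_basis b k u \<noteq> 0"
  proof -
    have "(\<lambda>k. dual_basis b k u) \<noteq> (\<lambda>k. 0)"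
    proof
      assume "(\<lambda>k. dual_basis b k u) = (\<lambda>k. 0)"
      then have "tlincomb (\<lambda>k. 0) b = u"
        using tlincomb_dual_basis[OF sm b u(1)] by simp
      then show False using u(2) by (simp add: tlincomb_def)
    qed
    then show ?thesis using that by auto
  qed
  have "0 < (\<Sum>k\<in>UNIV. \<sigma> k * (dual_basis b k u)\<^sup>2)"
    by (rule sum_pos2[of _ k]) (use k assms in \<open>auto simp: less_imp_le\<close>)
  then show "0 < diagonal_form (tangent_space X p) b \<sigma> u u"
    using u by (simp add: diagonal_form_def power2_eq_square mult.assoc)
qed (auto simp: diagonal_form_def dual_basis_tadd dual_basis_tscale tadd_in_tangent_space[OF sm]
      tscale_in_tangent_space[OF sm] algebra_simps sum.distrib sum_distrib_left)

lemma diagonal_form_basis: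
  "diagonal_form (tangent_space X p) b \<sigma> (b k) (b l) = (if k = l then \<sigma> k else 0)"
proof -
  have "diagonal_form (tangent_space X p) b \<sigma> (b k) (b l)
    = (\<Sum>m\<in>UNIV. if m = k then if k = l then \<sigma> k else 0 else 0)"
    unfolding diagonal_form_def dual_basis_self[OF sm b]
    by (simp only: basis_in_tangent_space simp_thms if_True) (rule sum.cong, auto)
  then show ?thesis by simp
qed

lemma bilinear_on_diagonal:
  assumes B: "bilinear_on (tangent_space X p) B"
    and d: "\<And>k l. B (b k) (b l) = (if k = l then \<sigma> k else 0)"
    and u: "u \<in> tangent_space X p" and v: "v \<in> tangent_space X p"
  shows "B u v = (\<Sum>k\<in>UNIV. \<sigma> k * dual_basis b k u * dual_basis b k v)"
proof -
  have "B u v = (\<Sum>k\<in>UNIV. \<Sum>l\<in>UNIV.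
      if k = l then \<sigma> k * dual_basis b k u * dual_basis b k v else 0)"
    unfolding bilinear_on_expand[OF sm B b u v] d by (intro sum.cong) auto
  then show ?thesis by simp
qed

lemma orthonormal_coordinate:
  assumes B: "bilinear_on (tangent_space X p) B" and o: "orthonormal B b"
    and u: "u \<in> tangent_space X p"
  shows "B (b k) u = dual_basis b k u"
proof -
  have "B (b k) u = (\<Sum>l\<in>UNIV. 1 * dual_basis b l (b k) * dual_basis b l u)"
    using o by (intro bilinear_on_diagonal[OF B _ basis_in_tangent_space u])
      (simp add: orthonormal_def)
  also have "\<dots> = (\<Sum>l\<in>UNIV. if l = k then dual_basis b l u else 0)"
    by (rule sum.cong) (simp_all add: dual_basis_self[OF sm b])
  finally show ?thesis by simp
qed

end

section \<open>The deformed metric in terms of \<open>gmet\<close> and \<open>form\<close>\<close>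

lemma sum_idx:
  "(\<Sum>k\<in>UNIV. f k) = (\<Sum>i\<in>UNIV. f (Inl i)) + (\<Sum>m\<in>UNIV. \<Sum>i\<in>UNIV. f (Inr (m, i)))"
  for f :: "'n::finite idx \<Rightarrow> real"
  unfolding sum.cartesian_product
  by (subst UNIV_Plus_UNIV[symmetric], subst sum.Plus) (simp_all add: UNIV_Times_UNIV[symmetric] del: UNIV_Times_UNIV)

lemma flat_metric_eq: "flat_metric c u v = (\<Sum>k\<in>UNIV. u c $ k * v c $ k)"
  unfolding flat_metric_def sum_idx coord_form_def
  by (subst (2) sum.swap) simp

context
  fixes X :: "('a, 'n::finite) two_sympl" and p b and j :: 2
  assumes sm: "smooth_manifold X" and b: "standard_polysymplectic_basis X p b"
    and o: "orthonormal (gmet X p) b"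
    and g: "bilinear_on (tangent_space X p) (gmet X p)"
begin

private lemma basis: "is_basis (tangent_space X p) b"
  using b by (simp add: standard_polysymplectic_basis_def)

private lemma bT: "b k \<in> tangent_space X p"
  using basis by (simp add: is_basis_def)

private lemma form_eq:
  "u \<in> tangent_space X p \<Longrightarrow> v \<in> tangent_space X p \<Longrightarrow> form X j p u v =
    (\<Sum>i\<in>UNIV. wedge (dual_basis b (Inl i)) (dual_basis b (Inr (j, i))) u v)"
  using b by (simp add: standard_polysymplectic_basis_def)

text \<open>The vector \<open>a\<close> is A u, given by its defining property, so that the
  right-hand side mentions no basis. The term \<open>form X j p a v\<close> is the part of
  \<open>gmet X p u v\<close> coming from the v_i and w_i^j; \<open>B\<close> is t times the metric
  on that part and 1/t times the metric on the rest.\<close>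

lemma deformed_metric_formula:
  assumes B: "bilinear_on (tangent_space X p) B"
    and d: "\<And>k l. B (b k) (b l) = (if k = l then deformed_sqlen j t k else 0)"
    and T: "u \<in> tangent_space X p" "v \<in> tangent_space X p" "a \<in> tangent_space X p"
    and a: "\<And>w. w \<in> tangent_space X p \<Longrightarrow> gmet X p w a = form X j p w u"
  shows "B u v = inverse t * gmet X p u v + (t - inverse t) * form X j p a v"
proof -
  define x where "x = dual_basis b"
  \<comment> \<open>\<open>S m\<close> and \<open>S0\<close> are the contributions of the w_i^m and
    of the v_i to the inner product of \<open>u\<close> and \<open>v\<close>.\<close>
  define S where "S m = (\<Sum>i\<in>UNIV. x (Inr (m, i)) u * x (Inr (m, i)) v)" for m
  define S0 where "S0 = (\<Sum>i\<in>UNIV. x (Inl i) u * x (Inl i) v)"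
  have xb: "x k (b l) = (if k = l then 1 else 0)" for k l
    unfolding x_def by (rule dual_basis_self[OF sm basis])
  have "B u v = (\<Sum>k\<in>UNIV. deformed_sqlen j t k * x k u * x k v)"
    unfolding x_def by (rule bilinear_on_diagonal[OF sm basis B d T(1,2)])
  also have "\<dots> = t * S0 + (\<Sum>m\<in>UNIV. (if m = j then t else inverse t) * S m)"
    by (simp add: sum_idx S0_def S_def sum_distrib_left mult.assoc)
  \<comment> \<open>Write t as 1/t + (t - 1/t) in the block m = j, so that 1/t multiplies the whole
    sum.\<close>
  also have "(\<Sum>m\<in>UNIV. (if m = j then t else inverse t) * S m)
      = (\<Sum>m\<in>UNIV. inverse t * S m + (if m = j then (t - inverse t) * S m else 0))"
    by (rule sum.cong) (auto simp: algebra_simps)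
  also have "\<dots> = inverse t * (\<Sum>m\<in>UNIV. S m) + (t - inverse t) * S j"
    by (simp add: sum.distrib sum_distrib_left)
  finally have Buv: "B u v = t * S0 + (inverse t * (\<Sum>m\<in>UNIV. S m) + (t - inverse t) * S j)" .
  have "gmet X p u v = (\<Sum>k\<in>UNIV. 1 * x k u * x k v)"
    unfolding x_def using o
    by (intro bilinear_on_diagonal[OF sm basis g _ T(1,2)]) (simp add: orthonormal_def)
  then have guv: "gmet X p u v = S0 + (\<Sum>m\<in>UNIV. S m)"
    by (simp add: sum_idx S0_def S_def)
  have xa: "x k a = form X j p (b k) u" for k
    unfolding x_def orthonormal_coordinate[OF sm basis g o T(3), symmetric] by (rule a[OF bT])
  have pick: "(\<Sum>i'\<in>UNIV. wedge (x (Inl i')) (x (Inr (j, i'))) (b (Inl i)) u)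
      = (\<Sum>i'\<in>UNIV. if i' = i then x (Inr (j, i')) u else 0)"
    "(\<Sum>i'\<in>UNIV. wedge (x (Inl i')) (x (Inr (j, i'))) (b (Inr (j, i))) u)
      = (\<Sum>i'\<in>UNIV. if i' = i then - x (Inl i') u else 0)" for i
    by (rule sum.cong; simp add: wedge_def xb)+
  \<comment> \<open>A sends w_i^j to v_i and v_i to -w_i^j. The minus sign cancels the one in the
    wedge product, so that \<open>form X j p a v\<close> is the sum \<open>S0 + S j\<close>.\<close>
  have xa1: "x (Inl i) a = x (Inr (j, i)) u" and xa2: "x (Inr (j, i)) a = - x (Inl i) u" for i
    unfolding xa form_eq[OF bT T(1), folded x_def] pick by simp_all
  have "form X j p a v = S0 + S j"
    unfolding form_eq[OF T(3,2), folded x_def] S0_def S_def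
    by (simp add: wedge_def xa1 xa2 sum.distrib algebra_simps)
  then show ?thesis unfolding Buv guv by (simp add: algebra_simps)
qed

text \<open>Riesz representation of the functional \<open>\<lambda>w. form X j p w u\<close>: in an
  orthonormal basis the coordinates of the representing vector are the values of the functional on
  the basis.\<close>

lemma ex_metric_adjoint:
  assumes u: "u \<in> tangent_space X p"
    and f: "bilinear_on (tangent_space X p) (form X j p)"
  shows "\<exists>a\<in>tangent_space X p. \<forall>w\<in>tangent_space X p. gmet X p w a = form X j p w u"
proof (intro bexI ballI)
  fix w assume w: "w \<in> tangent_space X p"
  have "gmet X p w (tlincomb (\<lambda>k. form X j p (b k) u) b)
      = (\<Sum>k\<in>UNIV. 1 * dual_basis b k w * dual_basis b k (tlincomb (\<lambda>k. form X j p (b k) u) b))"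
    using o by (intro bilinear_on_diagonal[OF sm basis g _ w] tlincomb_in_tangent_space[OF sm bT])
      (simp add: orthonormal_def)
  also have "\<dots> = form X j p (tlincomb (\<lambda>k. dual_basis b k w) b) u"
    by (simp add: dual_basis_tlincomb[OF sm basis] bilinear_on_tlincomb[OF sm f bT u])
  finally show "gmet X p w (tlincomb (\<lambda>k. form X j p (b k) u) b) = form X j p w u"
    by (simp add: tlincomb_dual_basis[OF sm basis w])
qed (rule tlincomb_in_tangent_space[OF sm bT])

end

section \<open>Kaehler charts and well-definedness of the deformed metric\<close>

lemma two_kaehlerD:
  assumes "two_kaehler X"
  shows "smooth_manifold X" "riemannian_metric X (gmet X)" "two_form X (form X j)"
    "smooth_tensor2 X (gmet X)" "smooth_tensor2 X (form X j)"
    "p \<in> topspace (topol X) \<Longrightarrow> inner_product_on (tangent_space X p) (gmet X p)"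
    "p \<in> topspace (topol X) \<Longrightarrow> bilinear_on (tangent_space X p) (gmet X p)"
    "p \<in> topspace (topol X) \<Longrightarrow> bilinear_on (tangent_space X p) (form X j p)"
  using assms unfolding two_kaehler_def riemannian_metric_def two_form_def smooth_tensor2_def
  by blast+

text \<open>Isolates the local condition in \<open>two_kaehler\<close>, so that a chart for the
  deformed structure can be built from one for the given structure.\<close>

definition kaehler_chart_at :: "('a, 'n::finite) two_sympl \<Rightarrow> 'a \<Rightarrow> ('a, 'n idx) chart \<Rightarrow> bool" where
  "kaehler_chart_at X p c \<longleftrightarrow> c \<in> charts_at X p \<and> snd c p = 0 \<and>
        (\<forall>j. \<forall>q\<in>fst c. \<forall>u\<in>tangent_space X q. \<forall>v\<in>tangent_space X q.
           form X j q u v = darboux_form c j u v) \<and>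
        (\<forall>k l. tensor_component X (\<lambda>q u v. gmet X q u v - flat_metric c u v) c k l
           \<in> O[nhds 0](\<lambda>z. (norm z)\<^sup>2))"

lemma two_kaehler_iff:
  "two_kaehler X \<longleftrightarrow> smooth_manifold X \<and> riemannian_metric X (gmet X) \<and>
    (\<forall>j. two_form X (form X j)) \<and> (\<forall>p\<in>topspace (topol X). \<exists>c. kaehler_chart_at X p c)"
  unfolding two_kaehler_def kaehler_chart_at_def by blast

lemma flat_metric_coord_vec:
  assumes "smooth_manifold X" "c \<in> charts_at X p"
  shows "flat_metric c (coord_vec X c k p) (coord_vec X c l p) = (if k = l then 1 else 0)"
proof -
  have "flat_metric c (coord_vec X c k p) (coord_vec X c l p)
      = (\<Sum>m\<in>UNIV. if m = k then if k = l then 1 else 0 else 0)"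
    unfolding flat_metric_eq coord_vec_chart[OF assms] by (rule sum.cong) (auto simp: axis_def)
  then show ?thesis by simp
qed

lemma kaehler_chart_standard_basis:
  assumes sm: "smooth_manifold X" and c: "kaehler_chart_at X p c"
  shows "standard_polysymplectic_basis X p (\<lambda>k. coord_vec X c k p)"
    and "orthonormal (gmet X p) (\<lambda>k. coord_vec X c k p)"
proof -
  have cp: "c \<in> charts_at X p" "snd c p = 0" using c by (simp_all add: kaehler_chart_at_def)
  show "standard_polysymplectic_basis X p (\<lambda>k. coord_vec X c k p)"
    using c charts_atD(3)[OF sm cp(1)]
    by (simp add: standard_polysymplectic_basis_def is_basis_coord_vec[OF sm cp(1)]
        kaehler_chart_at_def darboux_form_def wedge_def coord_form_def
        dual_basis_coord_vec[OF sm cp(1)])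
  show "orthonormal (gmet X p) (\<lambda>k. coord_vec X c k p)"
    unfolding orthonormal_def
  proof (intro allI)
    fix k l
    let ?f = "tensor_component X (\<lambda>q u v. gmet X q u v - flat_metric c u v) c k l"
    have "?f \<in> O[nhds 0](\<lambda>z. (norm z)\<^sup>2)" using c by (simp add: kaehler_chart_at_def)
    then obtain C where "\<forall>\<^sub>F z in nhds 0. norm (?f z) \<le> C * norm ((norm z)\<^sup>2)"
      by (rule landau_o.bigE)
    \<comment> \<open>An eventual property along \<open>nhds 0\<close> holds at 0 itself, where the
      bound C * norm(z)^2 is 0.\<close>
    then have "?f 0 = 0" by (auto dest!: eventually_nhds_x_imp_x)
    moreover have "chart_inv c 0 = p"
      using chart_inv_chart[OF charts_atD(2,3)[OF sm cp(1)]] cp(2) by simp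
    ultimately show "gmet X p (coord_vec X c k p) (coord_vec X c l p) = (if k = l then 1 else 0)"
      by (simp add: tensor_component_def flat_metric_coord_vec[OF sm cp(1)])
  qed
qed

lemma deformed_sqlen_pos: "0 < t \<Longrightarrow> 0 < deformed_sqlen j t k"
  by (cases "(j, t, k)" rule: deformed_sqlen.cases) auto

text \<open>Shows that the definite description in \<open>deformed_metric\<close> denotes: a
  diagonal form in one basis exists, and by the basis-free formula it serves every admissible basis
  and is the only choice.\<close>

lemma deformed_metric_spec:
  fixes X :: "('a, 'n::finite) two_sympl"
  assumes X: "two_kaehler X" and t: "0 < t" and p: "p \<in> topspace (topol X)"
  shows "inner_product_on (tangent_space X p) (deformed_metric j t X p)"
    and "standard_polysymplectic_basis X p b \<Longrightarrow> orthonormal (gmet X p) b \<Longrightarrow>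
      deformed_metric j t X p (b k) (b l) = (if k = l then deformed_sqlen j t k else 0)"
proof -
  let ?T = "tangent_space X p"
  let ?std = "\<lambda>b. standard_polysymplectic_basis X p b \<and> orthonormal (gmet X p) b"
  let ?diag = "\<lambda>B b. \<forall>k l. B (b k) (b l) = (if k = l then deformed_sqlen j t k else 0)"
  let ?P = "\<lambda>B. inner_product_on ?T B \<and> (\<forall>u v. u \<notin> ?T \<or> v \<notin> ?T \<longrightarrow> B u v = 0) \<and>
      (\<forall>b. ?std b \<longrightarrow> ?diag B b)"
  note sm = two_kaehlerD(1)[OF X] and g = two_kaehlerD(7)[OF X p]
  \<comment> \<open>Two inner products, diagonal in possibly different admissible bases, both equal
    the same expression in \<open>gmet\<close>, \<open>form\<close> and the same
    \<open>a\<close>.\<close>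
  have agree: "B u v = B' u v"
    if H: "inner_product_on ?T B" "inner_product_on ?T B'" "?std b" "?std b'"
      "?diag B b" "?diag B' b'" "u \<in> ?T" "v \<in> ?T" for B B' b b' u v
  proof -
    obtain a where "a \<in> ?T" "\<And>w. w \<in> ?T \<Longrightarrow> gmet X p w a = form X j p w u"
      using ex_metric_adjoint[OF sm _ _ g \<open>u \<in> ?T\<close> two_kaehlerD(8)[OF X p]] H(3) by blast
    note * = deformed_metric_formula[OF sm _ _ g inner_product_on_imp_bilinear_on _ H(7,8) this]
    have "B u v = inverse t * gmet X p u v + (t - inverse t) * form X j p a v"
      by (rule *[of b]) (use H in auto)
    moreover have "B' u v = inverse t * gmet X p u v + (t - inverse t) * form X j p a v"
      by (rule *[of b']) (use H in auto)
    ultimately show ?thesis by simp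
  qed
  \<comment> \<open>The coordinate vectors of a Kaehler chart at \<open>p\<close> supply one
    admissible basis \<open>b0\<close>.\<close>
  obtain c where c: "kaehler_chart_at X p c" using X p by (auto simp: two_kaehler_iff)
  define b0 where "b0 = (\<lambda>k. coord_vec X c k p)"
  have b0: "?std b0" using kaehler_chart_standard_basis[OF sm c] by (simp add: b0_def)
  have basis: "is_basis ?T b" if "?std b" for b
    using that by (simp add: standard_polysymplectic_basis_def)
  define D where "D = (\<lambda>b :: 'n idx \<Rightarrow> ('a, 'n idx) tvec. diagonal_form ?T b (deformed_sqlen j t))"
  have D: "inner_product_on ?T (D b)" "?diag (D b) b" if "?std b" for b
    unfolding D_def
    using inner_product_on_diagonal_form[OF sm basis[OF that] deformed_sqlen_pos[OF t]]
      diagonal_form_basis[OF sm basis[OF that]] by auto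
  have "?P (D b0)"
  proof (intro conjI allI impI)
    show "inner_product_on ?T (D b0)" by (rule D(1)[OF b0])
    show "D b0 u v = 0" if "u \<notin> ?T \<or> v \<notin> ?T" for u v
      using that by (auto simp: D_def diagonal_form_def)
    \<comment> \<open>For another admissible \<open>b\<close>, the form \<open>D b\<close> is
      diagonal in \<open>b\<close> by construction and coincides with \<open>D b0\<close>.\<close>
    show "D b0 (b k) (b l) = (if k = l then deformed_sqlen j t k else 0)" if "?std b" for b k l
      using agree[OF D(1)[OF b0] D(1)[OF that] b0 that D(2)[OF b0] D(2)[OF that], of "b k" "b l"]
        basis_in_tangent_space[OF sm basis[OF that]] D(2)[OF that] by simp
  qed
  moreover have "B = D b0" if "?P B" for B
  proof (intro ext)
    fix u v
    show "B u v = D b0 u v"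
    proof (cases "u \<in> ?T \<and> v \<in> ?T")
      case True
      then show ?thesis
        using agree[of B "D b0" b0 b0 u v] that b0 D[OF b0] by blast
    next
      case False
      then show ?thesis using that by (auto simp: D_def diagonal_form_def)
    qed
  qed
  ultimately have "?P (deformed_metric j t X p)"
    unfolding deformed_metric_def by (rule theI)
  then show "inner_product_on ?T (deformed_metric j t X p)"
    "standard_polysymplectic_basis X p b \<Longrightarrow> orthonormal (gmet X p) b \<Longrightarrow>
      deformed_metric j t X p (b k) (b l) = (if k = l then deformed_sqlen j t k else 0)"
    by blast+
qed

section \<open>Smoothness and second order expansion of the deformed metric\<close>

definition tensor_matrix :: "('a, 'k::finite, 'z) manifold_scheme \<Rightarrow> ('a, 'k) tensor2 \<Rightarrow>
    ('a, 'k) chart \<Rightarrow> real^'k \<Rightarrow> real^'k^'k" where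
  "tensor_matrix X \<tau> c z = (\<chi> k l. tensor_component X \<tau> c k l z)"

lemma bigo_transform_eventually:
  "g \<in> O[F](h) \<Longrightarrow> \<forall>\<^sub>F z in F. f z = g z \<Longrightarrow> f \<in> O[F](h)"
  by (rule iffD2[OF landau_o.big.in_cong])

text \<open>The matrix \<open>G\<^sup>-\<^sup>1 \<Omega>\<close> written with Cramer's rule, so that its smoothness is that of a determinant.\<close>

definition adjoint_component :: "('a, 'k::finite, 'z) manifold_scheme \<Rightarrow> ('a, 'k) tensor2 \<Rightarrow>
    ('a, 'k) tensor2 \<Rightarrow> ('a, 'k) chart \<Rightarrow> 'k \<Rightarrow> 'k \<Rightarrow> real^'k \<Rightarrow> real" where
  "adjoint_component X g \<omega> c m l z =
     det (\<chi> i k. if k = m then tensor_component X \<omega> c i l z else tensor_component X g c i k z)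
       / det (tensor_matrix X g c z)"

context
  fixes X :: "('a, 'k::finite, 'z) manifold_scheme" and g
  assumes sm: "smooth_manifold X" and g: "riemannian_metric X g"
begin

text \<open>A kernel vector of the Gram matrix gives a tangent vector orthogonal to every coordinate
  vector, hence to itself.\<close>

lemma det_metric_nonzero:
  assumes c: "c \<in> atlas X" and z: "z \<in> snd c ` fst c"
  shows "det (tensor_matrix X g c z) \<noteq> 0"
proof -
  define q where "q = chart_inv c z"
  define E where "E = (\<lambda>k. coord_vec X c k q)"
  have cq: "c \<in> charts_at X q" unfolding q_def by (rule charts_at_chart_inv[OF sm c z])
  have ip: "inner_product_on (tangent_space X q) (g q)"
    using g charts_at_in_topspace[OF sm cq] by (simp add: riemannian_metric_def)
  note bl = inner_product_on_imp_bilinear_on[OF ip]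
  have ET: "E k \<in> tangent_space X q" for k
    unfolding E_def by (rule coord_vec_in_tangent_space[OF sm cq])
  have "x = 0" if x: "tensor_matrix X g c z *v x = 0" for x
  proof -
    define u where "u = tlincomb (\<lambda>k. x $ k) E"
    have uT: "u \<in> tangent_space X q" unfolding u_def by (rule tlincomb_in_tangent_space[OF sm ET])
    have "(\<Sum>l\<in>UNIV. g q (E k) (E l) * x $ l) = (tensor_matrix X g c z *v x) $ k" for k
      by (simp add: matrix_vector_mult_def tensor_matrix_def tensor_component_def Let_def E_def q_def)
    then have "g q (E k) u = 0" for k
      by (simp add: u_def bilinear_on_tlincomb[OF sm bl ET ET] x mult.commute)
    then have "g q u u = 0"
      by (subst (1) u_def) (simp add: bilinear_on_tlincomb(1)[OF sm bl ET uT])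
    then have "u = (\<lambda>c. 0)"
      using ip uT unfolding inner_product_on_def by (metis less_irrefl)
    then have "(\<chi> k. x $ k) = 0"
      using tlincomb_coord_vec[OF sm cq, of "\<lambda>k. x $ k"] unfolding u_def E_def by metis
    then show "x = 0" by simp
  qed
  then show ?thesis
    by (simp add: invertible_det_nz[symmetric] invertible_left_inverse matrix_left_invertible_ker)
qed

text \<open>Cramer's rule: column \<open>l\<close> of Y solves the linear system with matrix G and
  right-hand side column \<open>l\<close> of \<Omega>.\<close>

lemma metric_mult_adjoint_component:
  assumes "c \<in> atlas X" "z \<in> snd c ` fst c"
  shows "(\<Sum>m\<in>UNIV. tensor_component X g c k m z * adjoint_component X g \<omega> c m l z)
    = tensor_component X \<omega> c k l z"
proof -
  let ?G = "tensor_matrix X g c z"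
  have "?G *v (\<chi> m. adjoint_component X g \<omega> c m l z) = (\<chi> k. tensor_component X \<omega> c k l z)"
    unfolding cramer[OF det_metric_nonzero[OF assms]]
    by (simp add: adjoint_component_def tensor_matrix_def cong: if_cong)
  then show ?thesis by (simp add: vec_eq_iff matrix_vector_mult_def tensor_matrix_def)
qed

lemma smooth_on_adjoint_component:
  assumes \<omega>: "smooth_tensor2 X \<omega>" and c: "c \<in> atlas X"
  shows "smooth_on (snd c ` fst c) (adjoint_component X g \<omega> c m l)"
proof -
  have op: "open (snd c ` fst c)" using atlas_is_chart[OF sm c] by (simp add: is_chart_def)
  have sg: "smooth_on (snd c ` fst c) (tensor_component X g c k i)" for k i
    using g c by (simp add: riemannian_metric_def smooth_tensor2_def)
  have so: "smooth_on (snd c ` fst c) (tensor_component X \<omega> c k i)" for k i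
    using \<omega> c by (simp add: smooth_tensor2_def)
  show ?thesis
    unfolding adjoint_component_def[abs_def]
  proof (rule smooth_on_divide[OF op _ _ det_metric_nonzero[OF c]])
    show "smooth_on (snd c ` fst c) (\<lambda>z. det (tensor_matrix X g c z))"
      by (rule smooth_on_det[OF op]) (simp add: tensor_matrix_def sg)
    show "smooth_on (snd c ` fst c) (\<lambda>z. det (\<chi> i k. if k = m then tensor_component X \<omega> c i l z
        else tensor_component X g c i k z))"
    proof (rule smooth_on_det[OF op])
      fix i k
      show "smooth_on (snd c ` fst c) (\<lambda>z. (\<chi> i k. if k = m then tensor_component X \<omega> c i l z
        else tensor_component X g c i k z) $ i $ k)"
        by (cases "k = m") (simp_all add: sg so)
    qed
  qed
qed

text \<open>Column \<open>l\<close> of Y gives the coordinates of A applied to the coordinate vector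
  \<open>l\<close>. For \<open>w\<close> a coordinate vector this is the matrix identity G Y =
  \<Omega>; linearity in \<open>w\<close> does the rest.\<close>

lemma metric_adjoint_coord_vec:
  assumes \<omega>: "bilinear_on (tangent_space X q) (\<omega> q)"
    and c: "c \<in> atlas X" and z: "z \<in> snd c ` fst c" and q: "q = chart_inv c z"
    and w: "w \<in> tangent_space X q"
  shows "g q w (tlincomb (\<lambda>m. adjoint_component X g \<omega> c m l z) (\<lambda>m. coord_vec X c m q))
    = \<omega> q w (coord_vec X c l q)"
proof -
  define E where "E = (\<lambda>k. coord_vec X c k q)"
  define a where "a = tlincomb (\<lambda>m. adjoint_component X g \<omega> c m l z) E"
  have cq: "c \<in> charts_at X q" unfolding q by (rule charts_at_chart_inv[OF sm c z])
  have gb: "bilinear_on (tangent_space X q) (g q)"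
    using g charts_at_in_topspace[OF sm cq] by (simp add: riemannian_metric_def inner_product_on_def)
  have ET: "E k \<in> tangent_space X q" for k
    unfolding E_def by (rule coord_vec_in_tangent_space[OF sm cq])
  have aT: "a \<in> tangent_space X q" unfolding a_def by (rule tlincomb_in_tangent_space[OF sm ET])
  have "g q (E k) a = \<omega> q (E k) (E l)" for k
    using metric_mult_adjoint_component[OF c z, of k \<omega> l]
    by (simp add: a_def bilinear_on_tlincomb[OF sm gb ET ET])
      (simp add: tensor_component_def Let_def E_def q mult.commute)
  moreover have "tlincomb (\<lambda>k. w c $ k) E = w"
    unfolding E_def by (rule sym[OF iffD2[OF tangent_vector_eq_tlincomb_iff[OF sm cq w] refl]])
  ultimately have "g q w a = \<omega> q w (E l)"
    using bilinear_on_tlincomb(1)[where b = E and r = "\<lambda>k. w c $ k", OF sm gb ET aT]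
      bilinear_on_tlincomb(1)[where b = E and r = "\<lambda>k. w c $ k", OF sm \<omega> ET ET[of l]] by simp
  then show ?thesis unfolding a_def E_def .
qed

end

section \<open>The deformed metric in coordinates\<close>

context
  fixes X :: "('a, 'n::finite) two_sympl" and t :: real and j :: 2
  assumes X: "two_kaehler X" and t: "0 < t"
begin

private lemmas sm = two_kaehlerD(1)[OF X]
private lemmas g = two_kaehlerD(2)[OF X]

lemma deformed_metric_component:
  assumes c: "c \<in> atlas X" and z: "z \<in> snd c ` fst c"
  shows "tensor_component X (deformed_metric j t X) c k l z =
    inverse t * tensor_component X (gmet X) c k l z + (t - inverse t) *
    (\<Sum>m\<in>UNIV. adjoint_component X (gmet X) (form X j) c m k z * tensor_component X (form X j) c m l z)"
proof -
  define q where "q = chart_inv c z"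
  have cq: "c \<in> charts_at X q" unfolding q_def by (rule charts_at_chart_inv[OF sm c z])
  have qX: "q \<in> topspace (topol X)" by (rule charts_at_in_topspace[OF sm cq])
  note ET = coord_vec_in_tangent_space[OF sm cq]
  note f = two_kaehlerD(8)[OF X qX, of j]
  \<comment> \<open>The chart \<open>c\<close> is arbitrary; a Kaehler chart \<open>d\<close> at
    \<open>q\<close> only supplies the admissible basis required by the formula, whose outcome does
    not mention it.\<close>
  obtain d where "kaehler_chart_at X q d" using X qX by (auto simp: two_kaehler_iff)
  note d = kaehler_chart_standard_basis[OF sm this]
  let ?a = "tlincomb (\<lambda>m. adjoint_component X (gmet X) (form X j) c m k z) (\<lambda>m. coord_vec X c m q)"
  have "deformed_metric j t X q (coord_vec X c k q) (coord_vec X c l q) =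
      inverse t * gmet X q (coord_vec X c k q) (coord_vec X c l q)
      + (t - inverse t) * form X j q ?a (coord_vec X c l q)"
    by (rule deformed_metric_formula[OF sm d two_kaehlerD(7)[OF X qX]
          inner_product_on_imp_bilinear_on[OF deformed_metric_spec(1)[OF X t qX]]
          deformed_metric_spec(2)[OF X t qX d] ET ET tlincomb_in_tangent_space[OF sm ET]
          metric_adjoint_coord_vec[where \<omega> = "form X j", OF sm g f c z q_def]])
  then show ?thesis
    unfolding bilinear_on_tlincomb(1)[OF sm f ET ET] by (simp add: tensor_component_def Let_def q_def)
qed

lemma riemannian_metric_deformed_metric: "riemannian_metric X (deformed_metric j t X)"
  unfolding riemannian_metric_def smooth_tensor2_def
proof (intro conjI ballI allI)
  fix c k l assume c: "c \<in> atlas X"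
  let ?S = "snd c ` fst c"
  have op: "open ?S" using atlas_is_chart[OF sm c] by (simp add: is_chart_def)
  have s: "smooth_on ?S (tensor_component X (gmet X) c k l)"
    "smooth_on ?S (tensor_component X (form X j) c k l)" for k l
    using two_kaehlerD(4,5)[OF X] c by (simp_all add: smooth_tensor2_def)
  note Y = smooth_on_adjoint_component[OF sm g two_kaehlerD(5)[OF X] c]
  have "smooth_on ?S (\<lambda>z. inverse t * tensor_component X (gmet X) c k l z + (t - inverse t) *
    (\<Sum>m\<in>UNIV. adjoint_component X (gmet X) (form X j) c m k z * tensor_component X (form X j) c m l z))"
    by (intro smooth_on_add smooth_on_mult smooth_on_sum smooth_on_const op s Y)
  then show "smooth_on ?S (tensor_component X (deformed_metric j t X) c k l)"
    by (rule smooth_on_cong[OF op, rotated]) (rule deformed_metric_component[OF c, symmetric])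
next
  fix p assume "p \<in> topspace (topol X)"
  then show "inner_product_on (tangent_space X p) (deformed_metric j t X p)"
    by (rule deformed_metric_spec(1)[OF X t])
  then show "bilinear_on (tangent_space X p) (deformed_metric j t X p)"
    by (rule inner_product_on_imp_bilinear_on)
qed

lemma deformed_metric_second_order:
  assumes c: "kaehler_chart_at X p c"
  shows "(\<lambda>z. tensor_component X (deformed_metric j t X) c k l z
      - (if k = l then deformed_sqlen j t k else 0)) \<in> O[nhds 0](\<lambda>z. (norm z)\<^sup>2)"
proof -
  let ?S = "snd c ` fst c"
  \<comment> \<open>The constant matrix \<Omega>. The arguments are not tangent vectors, but
    \<open>darboux_form c\<close> only reads their value at \<open>c\<close>.\<close>
  define W where "W m l = darboux_form c j (\<lambda>_. axis m 1) (\<lambda>_. axis l 1)" for m l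
  define Y where "Y = adjoint_component X (gmet X) (form X j) c"
  define G where "G = tensor_component X (gmet X) c"
  define R where "R = tensor_component X (\<lambda>q u v. gmet X q u v - flat_metric c u v) c"
  have cp: "c \<in> charts_at X p" "snd c p = 0" using c by (simp_all add: kaehler_chart_at_def)
  note ca = charts_atD(1)[OF sm cp(1)]
  have op: "open ?S" and S0: "0 \<in> ?S"
    using charts_atD(4,6)[OF sm cp(1)] cp(2) by auto
  have pX: "p \<in> topspace (topol X)" by (rule charts_at_in_topspace[OF sm cp(1)])
  have inv0: "chart_inv c 0 = p"
    using chart_inv_chart[OF charts_atD(2,3)[OF sm cp(1)]] cp(2) by simp
  have RG: "G k l z = (if k = l then 1 else 0) + R k l z" if "z \<in> ?S" for k l z
    using flat_metric_coord_vec[OF sm charts_at_chart_inv[OF sm ca that]]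
    by (simp add: G_def R_def tensor_component_def Let_def)
  have W: "tensor_component X (form X j) c m l z = W m l" if z: "z \<in> ?S" for m l z
  proof -
    note cq = charts_at_chart_inv[OF sm ca z]
    have "form X j q u v = darboux_form c j u v"
      if "q \<in> fst c" "u \<in> tangent_space X q" "v \<in> tangent_space X q" for q u v
      using c that by (simp add: kaehler_chart_at_def)
    from this[OF charts_atD(3)[OF sm cq] coord_vec_in_tangent_space[OF sm cq]
        coord_vec_in_tangent_space[OF sm cq]]
    show ?thesis
      by (simp add: tensor_component_def Let_def W_def darboux_form_def wedge_def coord_form_def
          coord_vec_chart[OF sm cq])
  qed
  \<comment> \<open>This is G Y = \<Omega> with G = I + R, solved for the leading Y.\<close>
  have YW: "Y m k z = W m k - (\<Sum>r\<in>UNIV. R m r z * Y r k z)" if z: "z \<in> ?S" for m k z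
  proof -
    have "W m k = (\<Sum>r\<in>UNIV. G m r z * Y r k z)"
      using metric_mult_adjoint_component[OF sm g ca z, of m "form X j" k] W[OF z]
      by (simp add: G_def Y_def)
    also have "\<dots> = (\<Sum>r\<in>UNIV. (if m = r then Y r k z else 0) + R m r z * Y r k z)"
      by (rule sum.cong) (auto simp: RG[OF z] algebra_simps)
    finally show ?thesis by (simp add: sum.distrib)
  qed
  have D: "tensor_component X (deformed_metric j t X) c k l z
      = inverse t * G k l z + (t - inverse t) * (\<Sum>m\<in>UNIV. Y m k z * W m l)" if "z \<in> ?S" for z
    using deformed_metric_component[OF ca that] W[OF that] by (simp add: G_def Y_def)
  have G0: "G k l 0 = (if k = l then 1 else 0)" for k l
    using kaehler_chart_standard_basis(2)[OF sm c]
    by (simp add: G_def tensor_component_def Let_def inv0 orthonormal_def)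
  then have R0: "R k l 0 = 0" for k l using RG[OF S0, of k l] by simp
  then have Y0: "Y m k 0 = W m k" for m k using YW[OF S0, of m k] by simp
  \<comment> \<open>The constant term is found by evaluating at 0, where the coordinate vectors form
    an admissible basis; the product of \<Omega> with its transpose need not be computed.\<close>
  have "(if k = l then deformed_sqlen j t k else 0)
      = tensor_component X (deformed_metric j t X) c k l 0"
    using deformed_metric_spec(2)[OF X t pX kaehler_chart_standard_basis[OF sm c]]
    by (simp add: tensor_component_def Let_def inv0)
  also have "\<dots> = inverse t * (if k = l then 1 else 0) + (t - inverse t) * (\<Sum>m\<in>UNIV. W m k * W m l)"
    by (simp add: D[OF S0] G0 Y0)
  finally have e0: "(if k = l then deformed_sqlen j t k else 0)
      = inverse t * (if k = l then 1 else 0) + (t - inverse t) * (\<Sum>m\<in>UNIV. W m k * W m l)" .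
  \<comment> \<open>Subtracting the value at 0 cancels the constant part, and every remaining term
    carries a factor \<open>R\<close>.\<close>
  have eq: "tensor_component X (deformed_metric j t X) c k l z
      - (if k = l then deformed_sqlen j t k else 0)
      = inverse t * R k l z - (t - inverse t) * (\<Sum>m\<in>UNIV. (\<Sum>r\<in>UNIV. R m r z * Y r k z) * W m l)"
    if "z \<in> ?S" for z
  proof -
    have "Y m k z * W m l = W m k * W m l - (\<Sum>r\<in>UNIV. R m r z * Y r k z) * W m l" for m
      by (subst YW[OF that]) (rule left_diff_distrib)
    then have *: "(\<Sum>m\<in>UNIV. Y m k z * W m l) = (\<Sum>m\<in>UNIV. W m k * W m l)
        - (\<Sum>m\<in>UNIV. (\<Sum>r\<in>UNIV. R m r z * Y r k z) * W m l)"
      by (subst sum_subtractf[symmetric]) (rule sum.cong, simp, assumption)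
    show ?thesis
      unfolding D[OF that] RG[OF that] e0 * by (simp only: algebra_simps)
  qed
  have RO: "R k l \<in> O[nhds 0](\<lambda>z. (norm z)\<^sup>2)" for k l
    using c by (simp add: R_def kaehler_chart_at_def)
  \<comment> \<open>Boundedness of Y near 0, from continuity, suffices because \<open>R\<close>
    already contributes order two.\<close>
  have YO: "Y r k \<in> O[nhds 0](\<lambda>_. 1)" for r k
  proof -
    have "continuous_on ?S (Y r k)"
      unfolding Y_def
      by (rule smooth_on_imp_continuous_on[OF smooth_on_adjoint_component[OF sm g two_kaehlerD(5)[OF X] ca]])
    then have "isCont (Y r k) 0" using op S0 continuous_on_eq_continuous_at by blast
    then have "((\<lambda>z. norm (Y r k z)) \<longlongrightarrow> norm (Y r k 0)) (nhds 0)"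
      by (intro tendsto_norm) (simp add: isCont_def tendsto_at_iff_tendsto_nhds)
    then have "\<forall>\<^sub>F z in nhds 0. norm (Y r k z) < norm (Y r k 0) + 1"
      by (rule order_tendstoD(2)) simp
    then show ?thesis
      by (intro bigoI[of _ "norm (Y r k 0) + 1"]) (auto elim!: eventually_mono)
  qed
  have "(\<lambda>z. R m r z * Y r k z) \<in> O[nhds 0](\<lambda>z. (norm z)\<^sup>2)" for m r
    using landau_o.big.mult[OF RO YO] by simp
  then have "(\<lambda>z. inverse t * R k l z - (t - inverse t) *
      (\<Sum>m\<in>UNIV. (\<Sum>r\<in>UNIV. R m r z * Y r k z) * W m l)) \<in> O[nhds 0](\<lambda>z. (norm z)\<^sup>2)"
    by (intro sum_in_bigo(2)) (auto simp: RO mult.commute[of _ "W _ _"] intro!: big_sum_in_bigo)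
  moreover have "\<forall>\<^sub>F z in nhds 0. tensor_component X (deformed_metric j t X) c k l z
      - (if k = l then deformed_sqlen j t k else 0) = inverse t * R k l z - (t - inverse t) *
      (\<Sum>m\<in>UNIV. (\<Sum>r\<in>UNIV. R m r z * Y r k z) * W m l)"
    by (rule eventually_mono[OF eventually_nhds_in_open[OF op S0] eq])
  ultimately show ?thesis by (rule bigo_transform_eventually)
qed

end

section \<open>Rescaled charts\<close>

definition rescale :: "('k::finite \<Rightarrow> real) \<Rightarrow> real^'k \<Rightarrow> real^'k" where
  "rescale s v = (\<chi> k. s k * v $ k)"

definition rescale_chart :: "('k::finite \<Rightarrow> real) \<Rightarrow> ('a, 'k) chart \<Rightarrow> ('a, 'k) chart" where
  "rescale_chart s c = (fst c, rescale s \<circ> snd c)"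

lemma rescale_chart_simps [simp]:
  "fst (rescale_chart s c) = fst c" "snd (rescale_chart s c) q = rescale s (snd c q)"
  by (simp_all add: rescale_chart_def)

lemma rescale_nth [simp]: "rescale s v $ k = s k * v $ k"
  by (simp add: rescale_def)

lemma bounded_linear_rescale: "bounded_linear (rescale s)"
  by (rule linear_conv_bounded_linear[THEN iffD1], rule linearI) (simp_all add: vec_eq_iff algebra_simps)

lemma rescale_0 [simp]: "rescale s 0 = 0"
  by (simp add: vec_eq_iff)

lemma continuous_on_rescale: "continuous_on A (rescale s)"
  by (rule linear_continuous_on[OF bounded_linear_rescale])

context
  fixes s :: "'k::finite \<Rightarrow> real"
  assumes s: "\<And>k. s k \<noteq> 0"
begin

lemma rescale_inverse [simp]:
  "rescale (\<lambda>k. inverse (s k)) (rescale s v) = v" "rescale s (rescale (\<lambda>k. inverse (s k)) v) = v"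
  by (simp_all add: vec_eq_iff s)

text \<open>The image is the preimage under the inverse rescaling, which is continuous.\<close>

lemma open_image_rescale: "open A \<Longrightarrow> open (rescale s ` A)"
proof -
  assume A: "open A"
  have "rescale s ` A = rescale (\<lambda>k. inverse (s k)) -` A"
    by (auto intro: image_eqI[where x = "rescale (\<lambda>k. inverse (s k)) _"])
  then show ?thesis
    using continuous_on_rescale[of UNIV "\<lambda>k. inverse (s k)"] A
    by (simp add: open_vimage continuous_on_open_vimage)
qed

lemma image_rescale_chart: "snd (rescale_chart s c) ` A = rescale s ` snd c ` A"
  by (auto simp: rescale_chart_def)

lemma is_chart_rescale_chart:
  assumes c: "is_chart M c"
  shows "is_chart M (rescale_chart s c)"
proof -
  let ?S = "snd c ` fst c"
  have "homeomorphic_maps (top_of_set ?S) (top_of_set (rescale s ` ?S))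
      (rescale s) (rescale (\<lambda>k. inverse (s k)))"
    by (auto simp: homeomorphic_maps_def continuous_on_rescale)
  then have "homeomorphic_map (top_of_set ?S) (top_of_set (rescale s ` ?S)) (rescale s)"
    by (rule homeomorphic_maps_imp_map)
  then have "homeomorphic_map (subtopology M (fst c)) (top_of_set (rescale s ` ?S)) (rescale s \<circ> snd c)"
    using c homeomorphic_map_compose unfolding is_chart_def by blast
  then show ?thesis
    using c open_image_rescale unfolding is_chart_def image_rescale_chart
    by (simp add: rescale_chart_def)
qed

context
  fixes X :: "('a, 'k, 'z) manifold_scheme" and c
  assumes sm: "smooth_manifold X" and ca: "c \<in> atlas X"
begin

private lemma chart_c: "is_chart (topol X) c"
  by (rule atlas_is_chart[OF sm ca])

lemma chart_inv_rescale_chart: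
  assumes "z \<in> snd c ` fst c"
  shows "chart_inv (rescale_chart s c) (rescale s z) = chart_inv c z"
proof -
  obtain q where "q \<in> fst c" "z = snd c q" using assms by auto
  then show ?thesis
    using chart_inv_chart[OF is_chart_rescale_chart[OF chart_c], of q]
      chart_inv_chart[OF chart_c, of q] by simp
qed

text \<open>The transitions are those of \<open>c\<close>, precomposed with the inverse rescaling in
  one direction and followed by the rescaling in the other.\<close>

lemma compatible_rescale_chart:
  assumes d: "d \<in> atlas X"
  shows "compatible (rescale_chart s c) d"
proof -
  let ?A = "fst c \<inter> fst d"
  have cd: "smooth_on (snd c ` ?A) (transition c d)" "smooth_on (snd d ` ?A) (transition d c)"
    using sm ca d by (simp_all add: smooth_manifold_def compatible_def)
  have op: "open (snd c ` ?A)" "open (snd d ` ?A)"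
    using open_chart_overlap[OF sm ca d] open_chart_overlap[OF sm d ca] by (simp_all add: Int_commute)
  have "smooth_on (rescale s ` snd c ` ?A) (\<lambda>z. transition c d (rescale (\<lambda>k. inverse (s k)) z))"
    unfolding smooth_on_def
  proof
    fix n
    show "Ck_on n (rescale s ` snd c ` ?A) (\<lambda>z. transition c d (rescale (\<lambda>k. inverse (s k)) z))"
      by (rule Ck_on_linear_comp_right[OF op(1) open_image_rescale[OF op(1)] bounded_linear_rescale])
        (use cd(1) in \<open>auto simp: smooth_on_def\<close>)
  qed
  then have "smooth_on (rescale s ` snd c ` ?A) (transition (rescale_chart s c) d)"
    by (rule smooth_on_cong[OF open_image_rescale[OF op(1)], rotated])
      (auto simp: transition_def chart_inv_rescale_chart)
  moreover have "smooth_on (snd d ` ?A) (transition d (rescale_chart s c))"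
    using cd(2) Ck_on_linear_comp_left[OF op(2) bounded_linear_rescale, of _ "transition d c" s]
    by (simp add: smooth_on_def transition_def rescale_chart_def o_def)
  ultimately show ?thesis
    unfolding compatible_def image_rescale_chart by simp
qed

text \<open>Maximality of the atlas admits every chart compatible with all its members.\<close>

lemma rescale_chart_in_atlas: "rescale_chart s c \<in> atlas X"
  using sm compatible_rescale_chart is_chart_rescale_chart[OF chart_c]
  unfolding smooth_manifold_def by blast

lemma rescale_chart_in_charts_at: "p \<in> fst c \<Longrightarrow> rescale_chart s c \<in> charts_at X p"
  using rescale_chart_in_atlas by (simp add: charts_at_def)

text \<open>The transition from \<open>c\<close> to the rescaled chart is the linear map
  \<open>rescale s\<close>, which is its own derivative.\<close>

lemma tangent_vector_rescale_chart:
  assumes u: "u \<in> tangent_space X q" and q: "q \<in> fst c"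
  shows "u (rescale_chart s c) = rescale s (u c)"
proof -
  have cq: "c \<in> charts_at X q" using ca q by (simp add: charts_at_def)
  have "(transition c (rescale_chart s c) has_derivative rescale s) (at (snd c q))"
    by (rule has_derivative_transform_within_open[OF bounded_linear_imp_has_derivative[OF
          bounded_linear_rescale] charts_atD(6,4)[OF sm cq]])
      (simp add: transition_def chart_chart_inv)
  then have "rescale s = frechet_derivative (transition c (rescale_chart s c)) (at (snd c q))"
    by (rule frechet_derivative_at)
  then show ?thesis
    using tangent_spaceD(1)[OF sm u cq rescale_chart_in_charts_at[OF q]] by simp
qed

lemma coord_vec_rescale_chart:
  assumes q: "q \<in> fst c"
  shows "coord_vec X (rescale_chart s c) k q = tscale (inverse (s k)) (coord_vec X c k q)"
proof (rule tangent_vectors_eqI[OF sm rescale_chart_in_charts_at[OF q]])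
  have cq: "c \<in> charts_at X q" using ca q by (simp add: charts_at_def)
  note cq' = rescale_chart_in_charts_at[OF q]
  note T = tscale_in_tangent_space[OF sm coord_vec_in_tangent_space[OF sm cq]]
  show "coord_vec X (rescale_chart s c) k q \<in> tangent_space X q"
    by (rule coord_vec_in_tangent_space[OF sm cq'])
  show "tscale (inverse (s k)) (coord_vec X c k q) \<in> tangent_space X q" by (rule T)
  show "coord_vec X (rescale_chart s c) k q (rescale_chart s c)
      = tscale (inverse (s k)) (coord_vec X c k q) (rescale_chart s c)"
    unfolding tangent_vector_rescale_chart[OF T q] coord_vec_chart[OF sm cq']
    unfolding tscale_def coord_vec_chart[OF sm cq]
    by (simp add: vec_eq_iff axis_def s)
qed

end

end

section \<open>Kaehler charts under rescaling\<close>

lemma bigo_square_compose_rescale: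
  assumes "f \<in> O[nhds 0](\<lambda>z. (norm z)\<^sup>2)"
  shows "(\<lambda>z. f (rescale s z)) \<in> O[nhds 0](\<lambda>z. (norm z)\<^sup>2)"
proof -
  obtain C where C: "\<forall>\<^sub>F z in nhds 0. norm (f z) \<le> C * norm ((norm z)\<^sup>2)"
    using assms by (rule landau_o.bigE)
  obtain K where K: "\<And>z. norm (rescale s z) \<le> norm z * K"
    using bounded_linear.bounded[OF bounded_linear_rescale] by blast
  have "filterlim (rescale s) (nhds 0) (nhds 0)"
    using continuous_on_rescale[of UNIV s]
    by (metis UNIV_I continuous_on_eq_continuous_at isCont_def open_UNIV rescale_0 tendsto_at_iff_tendsto_nhds)
  from eventually_compose_filterlim[OF C this]
  \<comment> \<open>\<open>K\<close> bounds the operator norm of the rescaling; the absolute value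
    keeps the estimate monotone if \<open>C\<close> is negative.\<close>
  have "\<forall>\<^sub>F z in nhds 0. norm (f (rescale s z)) \<le> (\<bar>C\<bar> * K\<^sup>2) * norm ((norm z)\<^sup>2)"
  proof (rule eventually_mono)
    fix z assume "norm (f (rescale s z)) \<le> C * norm ((norm (rescale s z))\<^sup>2)"
    also have "\<dots> \<le> \<bar>C\<bar> * (norm z * K)\<^sup>2"
      by (intro mult_mono) (auto intro!: power_mono K)
    finally show "norm (f (rescale s z)) \<le> (\<bar>C\<bar> * K\<^sup>2) * norm ((norm z)\<^sup>2)"
      by (simp add: power_mult_distrib mult_ac)
  qed
  then show ?thesis by (rule bigoI)
qed

text \<open>In the new coordinates s_k z_k the Darboux form number j gains the factor
  \<open>s (Inl i) * s (Inr (j, i))\<close>, which \<open>a\<close> makes independent of i, and the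
  metric components are divided by \<open>s k * s l\<close>, which turns the diagonal entries
  \<open>(s k)\<^sup>2\<close> into 1.\<close>

lemma kaehler_chart_rescale:
  fixes Y :: "('a, 'n::finite) two_sympl"
  assumes sm: "smooth_manifold Y" and g: "riemannian_metric Y (gmet Y)"
    and c: "c \<in> charts_at Y p" "snd c p = 0" and s: "\<And>k. s k \<noteq> 0"
    and form: "\<And>j q u v. q \<in> fst c \<Longrightarrow> u \<in> tangent_space Y q \<Longrightarrow> v \<in> tangent_space Y q \<Longrightarrow>
        form Y j q u v = a j * darboux_form c j u v"
    and a: "\<And>i j. s (Inl i) * s (Inr (j, i)) = a j"
    and met: "\<And>k l. (\<lambda>z. tensor_component Y (gmet Y) c k l z - (if k = l then (s k)\<^sup>2 else 0))
        \<in> O[nhds 0](\<lambda>z. (norm z)\<^sup>2)"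
  shows "kaehler_chart_at Y p (rescale_chart s c)"
  unfolding kaehler_chart_at_def
proof (intro conjI allI ballI)
  let ?c = "rescale_chart s c"
  let ?r = "\<lambda>k. inverse (s k)"
  note ca = charts_atD(1)[OF sm c(1)]
  show "?c \<in> charts_at Y p"
    by (rule rescale_chart_in_charts_at[where s = s, OF s sm ca charts_atD(3)[OF sm c(1)]])
  show "snd ?c p = 0" by (simp add: c(2))
  show "form Y j q u v = darboux_form ?c j u v"
    if "q \<in> fst ?c" "u \<in> tangent_space Y q" "v \<in> tangent_space Y q" for j q u v
  proof -
    have q: "q \<in> fst c" using that(1) by simp
    have rescaled: "s (Inl i) * x * (s (Inr (j, i)) * y) = a j * (x * y)" for i x y
      by (simp add: a[of i j, symmetric] mult_ac)
    show ?thesis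
      unfolding form[OF q that(2,3)] darboux_form_def sum_distrib_left wedge_def coord_form_def
        that(2,3)[THEN tangent_vector_rescale_chart[where s = s, OF s sm ca _ q]]
      by (simp add: rescaled right_diff_distrib)
  qed
  fix k l
  let ?f = "\<lambda>z. tensor_component Y (gmet Y) c k l z - (if k = l then (s k)\<^sup>2 else 0)"
  \<comment> \<open>\<open>rescale ?r\<close> returns from the new coordinates to the old ones, in
    which \<open>met\<close> is stated.\<close>
  have fO: "(\<lambda>z. (inverse (s k) * inverse (s l)) * ?f (rescale ?r z)) \<in> O[nhds 0](\<lambda>z. (norm z)\<^sup>2)"
    using bigo_square_compose_rescale[OF met[of k l], of ?r] by (simp add: s)
  have eq: "tensor_component Y (\<lambda>q u v. gmet Y q u v - flat_metric ?c u v) ?c k l z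
      = (inverse (s k) * inverse (s l)) * ?f (rescale ?r z)"
    if "z \<in> rescale s ` snd c ` fst c" for z
  proof -
    from that obtain y where y: "z = rescale s y" "y \<in> snd c ` fst c" by (rule imageE)
    define q where "q = chart_inv c y"
    have q: "q \<in> fst c" unfolding q_def by (rule chart_inv_in[OF charts_atD(2)[OF sm c(1)] y(2)]) simp
    have cq: "c \<in> charts_at Y q" using q ca by (simp add: charts_at_def)
    have gb: "bilinear_on (tangent_space Y q) (gmet Y q)"
      using g charts_at_in_topspace[OF sm cq] by (simp add: riemannian_metric_def inner_product_on_def)
    note E = coord_vec_in_tangent_space[OF sm cq]
    have "gmet Y q (coord_vec Y ?c k q) (coord_vec Y ?c l q)
        = inverse (s k) * inverse (s l) * gmet Y q (coord_vec Y c k q) (coord_vec Y c l q)"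
      unfolding coord_vec_rescale_chart[where s = s, OF s sm ca q]
      by (simp add: bilinear_onD(3,4)[OF gb] E tscale_in_tangent_space[OF sm E])
    then show ?thesis
      using chart_inv_rescale_chart[where s = s, OF s sm ca y(2)]
        flat_metric_coord_vec[OF sm rescale_chart_in_charts_at[where s = s, OF s sm ca q], of k l]
      by (simp add: tensor_component_def Let_def y(1) rescale_inverse[where s = s, OF s] q_def[symmetric]
          right_diff_distrib power2_eq_square) (simp add: s field_simps)
  qed
  have "open (rescale s ` snd c ` fst c)" "0 \<in> rescale s ` snd c ` fst c"
    using open_image_rescale[where s = s, OF s charts_atD(6)[OF sm c(1)]] charts_atD(4)[OF sm c(1)] c(2)
    by (auto simp: image_iff intro!: bexI[of _ p] charts_atD(3)[OF sm c(1)])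
  then have "\<forall>\<^sub>F z in nhds 0. z \<in> rescale s ` snd c ` fst c"
    by (rule eventually_nhds_in_open)
  then have "\<forall>\<^sub>F z in nhds 0. tensor_component Y (\<lambda>q u v. gmet Y q u v - flat_metric ?c u v) ?c k l z
      = (inverse (s k) * inverse (s l)) * ?f (rescale ?r z)"
    by (rule eventually_mono) (rule eq)
  with fO show "tensor_component Y (\<lambda>q u v. gmet Y q u v - flat_metric ?c u v) ?c k l
      \<in> O[nhds 0](\<lambda>z. (norm z)\<^sup>2)"
    by (rule bigo_transform_eventually)
qed

section \<open>The deformed structures\<close>

lemma smooth_tensor2_scale:
  assumes "smooth_manifold X" "smooth_tensor2 X \<tau>"
  shows "smooth_tensor2 X (\<lambda>p u v. a * \<tau> p u v)"
proof -
  have "smooth_on (snd c ` fst c) (tensor_component X (\<lambda>p u v. a * \<tau> p u v) c k l)"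
    if c: "c \<in> atlas X" for c k l
  proof -
    have "open (snd c ` fst c)" using atlas_is_chart[OF assms(1) c] by (simp add: is_chart_def)
    then have "smooth_on (snd c ` fst c) (\<lambda>z. a * tensor_component X \<tau> c k l z)"
      using assms(2) c by (intro smooth_on_mult smooth_on_const) (simp_all add: smooth_tensor2_def)
    then show ?thesis by (simp add: tensor_component_def[abs_def] Let_def)
  qed
  moreover have "bilinear_on (tangent_space X p) (\<lambda>u v. a * \<tau> p u v)"
    if "p \<in> topspace (topol X)" for p
    using assms(2) that by (simp add: smooth_tensor2_def bilinear_on_def distrib_left mult.left_commute)
  ultimately show ?thesis by (simp add: smooth_tensor2_def)
qed

lemma two_form_scale:
  assumes "smooth_manifold X" "two_form X \<tau>"
  shows "two_form X (\<lambda>p u v. a * \<tau> p u v)"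
  unfolding two_form_def
proof (intro conjI ballI)
  show "smooth_tensor2 X (\<lambda>p u v. a * \<tau> p u v)"
    using assms by (simp add: two_form_def smooth_tensor2_scale)
next
  fix p u v
  assume "p \<in> topspace (topol X)" "u \<in> tangent_space X p" "v \<in> tangent_space X p"
  then have "\<tau> p u v = - \<tau> p v u" using assms(2) unfolding two_form_def by blast
  then show "a * \<tau> p u v = - (a * \<tau> p v u)" by (metis mult_minus_right)
qed

lemma riemannian_metric_scale:
  "smooth_manifold X \<Longrightarrow> riemannian_metric X g \<Longrightarrow> 0 < a \<Longrightarrow> riemannian_metric X (\<lambda>p u v. a * g p u v)"
  using smooth_tensor2_scale[of X g a]
  by (simp add: riemannian_metric_def inner_product_on_def smooth_tensor2_def)

text \<open>These notions read only the topology and the atlas, which the update leaves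
  unchanged.\<close>

lemma two_sympl_update_simps [simp]:
  fixes X :: "('a, 'n::finite) two_sympl"
  defines "Y f g \<equiv> X\<lparr>form := f, gmet := g\<rparr>"
  shows "smooth_manifold (Y f g) = smooth_manifold X"
    and "charts_at (Y f g) = charts_at X"
    and "tangent_space (Y f g) = tangent_space X"
    and "coord_vec (Y f g) = coord_vec X"
    and "tensor_component (Y f g) = tensor_component X"
    and "smooth_tensor2 (Y f g) = smooth_tensor2 X"
    and "two_form (Y f g) = two_form X"
    and "riemannian_metric (Y f g) = riemannian_metric X"
proof -
  show charts: "charts_at (Y f g) = charts_at X" by (simp add: fun_eq_iff charts_at_def Y_def)
  show tangent: "tangent_space (Y f g) = tangent_space X"
    by (simp add: fun_eq_iff tangent_space_def charts)
  show coord: "coord_vec (Y f g) = coord_vec X"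
    by (simp add: fun_eq_iff coord_vec_def charts)
  show tensor: "tensor_component (Y f g) = tensor_component X"
    by (simp add: fun_eq_iff tensor_component_def coord)
  show smooth: "smooth_tensor2 (Y f g) = smooth_tensor2 X"
    by (simp add: fun_eq_iff smooth_tensor2_def tangent tensor) (simp add: Y_def)
  show "two_form (Y f g) = two_form X"
    by (simp add: fun_eq_iff two_form_def tangent smooth) (simp add: Y_def)
  show "riemannian_metric (Y f g) = riemannian_metric X"
    by (simp add: fun_eq_iff riemannian_metric_def tangent smooth) (simp add: Y_def)
  show "smooth_manifold (Y f g) = smooth_manifold X"
    by (simp add: smooth_manifold_def Y_def)
qed

text \<open>Common core of the three deformations. \<open>\<sigma>\<close> lists the squared lengths
  of the coordinate vectors at the centre; rescaling by their square roots normalises the metric,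
  and \<open>sq\<close> says that this also absorbs the factors \<open>a j\<close> of the
  forms.\<close>

lemma two_kaehler_update:
  fixes X :: "('a, 'n::finite) two_sympl"
  assumes X: "two_kaehler X" and g: "riemannian_metric X g"
    and form: "\<And>j p u v. f j p u v = a j * form X j p u v"
    and sq: "\<And>k. 0 < \<sigma> k" "\<And>i j. sqrt (\<sigma> (Inl i)) * sqrt (\<sigma> (Inr (j, i))) = a j"
    and met: "\<And>p c k l. kaehler_chart_at X p c \<Longrightarrow>
        (\<lambda>z. tensor_component X g c k l z - (if k = l then \<sigma> k else 0)) \<in> O[nhds 0](\<lambda>z. (norm z)\<^sup>2)"
  shows "two_kaehler (X\<lparr>form := f, gmet := g\<rparr>)"
proof -
  note sm = two_kaehlerD(1)[OF X]
  have fj: "f j = (\<lambda>p u v. a j * form X j p u v)" for j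
    by (intro ext form)
  have "\<exists>c. kaehler_chart_at (X\<lparr>form := f, gmet := g\<rparr>) p c" if p: "p \<in> topspace (topol X)" for p
  proof -
    obtain c where c: "kaehler_chart_at X p c" using X p by (auto simp: two_kaehler_iff)
    then have cp: "c \<in> charts_at X p" "snd c p = 0"
      and dx: "q \<in> fst c \<Longrightarrow> u \<in> tangent_space X q \<Longrightarrow> v \<in> tangent_space X q \<Longrightarrow>
        form X j q u v = darboux_form c j u v" for j q u v
      by (simp_all add: kaehler_chart_at_def)
    have "kaehler_chart_at (X\<lparr>form := f, gmet := g\<rparr>) p (rescale_chart (\<lambda>k. sqrt (\<sigma> k)) c)"
    proof (rule kaehler_chart_rescale[where a = a])
      show "sqrt (\<sigma> k) \<noteq> 0" for k using sq(1)[of k] by simp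
      show "(\<lambda>z. tensor_component (X\<lparr>form := f, gmet := g\<rparr>) (gmet (X\<lparr>form := f, gmet := g\<rparr>)) c k l z
          - (if k = l then (sqrt (\<sigma> k))\<^sup>2 else 0)) \<in> O[nhds 0](\<lambda>z. (norm z)\<^sup>2)" for k l
      proof -
        have "(sqrt (\<sigma> k))\<^sup>2 = \<sigma> k" "gmet (X\<lparr>form := f, gmet := g\<rparr>) = g"
          using sq(1)[of k] by simp_all
        then show ?thesis using met[OF c, of k l] by (simp only: two_sympl_update_simps)
      qed
    qed (simp_all add: sm g cp sq(2) form dx)
    then show ?thesis ..
  qed
  then show ?thesis
    using sm g two_kaehlerD(3)[OF X] by (simp add: two_kaehler_iff fj two_form_scale)
qed

lemma two_kaehler_deform:
  assumes X: "two_kaehler X" and t: "0 < t"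
  shows "two_kaehler (deform j t X)"
  unfolding deform_def
proof (rule two_kaehler_update[OF X, where a = "\<lambda>m. if m = j then t else 1" and \<sigma> = "deformed_sqlen j t"])
  show "riemannian_metric X (deformed_metric j t X)"
    by (rule riemannian_metric_deformed_metric[OF X t])
  show "0 < deformed_sqlen j t k" for k by (rule deformed_sqlen_pos[OF t])
  \<comment> \<open>The radicands multiply to t * t for m = j and to t * (1/t) otherwise, matching
    the factors t and 1 of the deformed forms.\<close>
  show "sqrt (deformed_sqlen j t (Inl i)) * sqrt (deformed_sqlen j t (Inr (m, i)))
      = (if m = j then t else 1)" for i m
    using t by (simp add: real_sqrt_mult[symmetric])
  show "(\<lambda>z. tensor_component X (deformed_metric j t X) c k l z
      - (if k = l then deformed_sqlen j t k else 0)) \<in> O[nhds 0](\<lambda>z. (norm z)\<^sup>2)"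
    if "kaehler_chart_at X p c" for p c k l
    by (rule deformed_metric_second_order[OF X t that])
qed simp

lemma two_kaehler_lambda_deform:
  assumes X: "two_kaehler X" and t: "0 < t"
  shows "two_kaehler (lambda_deform t X)"
  unfolding lambda_deform_def
proof (rule two_kaehler_update[OF X, where a = "\<lambda>m. t" and \<sigma> = "\<lambda>k. t"])
  note sm = two_kaehlerD(1)[OF X]
  show "riemannian_metric X (\<lambda>p u v. t * gmet X p u v)"
    by (rule riemannian_metric_scale[OF sm two_kaehlerD(2)[OF X] t])
  fix p c k l assume c: "kaehler_chart_at X p c"
  then have cp: "c \<in> charts_at X p" "snd c p = 0" by (simp_all add: kaehler_chart_at_def)
  let ?S = "snd c ` fst c"
  \<comment> \<open>Here all squared lengths are t, and the remainder is t times that of the given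
    metric.\<close>
  have "(\<lambda>z. t * tensor_component X (\<lambda>q u v. gmet X q u v - flat_metric c u v) c k l z)
      \<in> O[nhds 0](\<lambda>z. (norm z)\<^sup>2)"
    using c by (simp add: kaehler_chart_at_def)
  moreover have "\<forall>\<^sub>F z in nhds 0. z \<in> ?S"
    using charts_atD(4,6)[OF sm cp(1)] cp(2) by (intro eventually_nhds_in_open) simp_all
  then have "\<forall>\<^sub>F z in nhds 0. tensor_component X (\<lambda>p u v. t * gmet X p u v) c k l z - (if k = l then t else 0)
      = t * tensor_component X (\<lambda>q u v. gmet X q u v - flat_metric c u v) c k l z"
  proof (rule eventually_mono)
    fix z assume "z \<in> ?S"
    from flat_metric_coord_vec[OF sm charts_at_chart_inv[OF sm charts_atD(1)[OF sm cp(1)] this]]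
    show "tensor_component X (\<lambda>p u v. t * gmet X p u v) c k l z - (if k = l then t else 0)
      = t * tensor_component X (\<lambda>q u v. gmet X q u v - flat_metric c u v) c k l z"
      by (simp add: tensor_component_def Let_def right_diff_distrib)
  qed
  ultimately show "(\<lambda>z. tensor_component X (\<lambda>p u v. t * gmet X p u v) c k l z - (if k = l then t else 0))
      \<in> O[nhds 0](\<lambda>z. (norm z)\<^sup>2)"
    by (rule bigo_transform_eventually)
qed (use t in simp_all)

theorem proposition6p10:
  fixes X :: "('a, 'n::finite) two_sympl" and t :: real
  assumes "two_kaehler X" and "t > 0"
  shows "two_kaehler (alpha_deform t X) \<and> two_kaehler (beta_deform t X)
    \<and> two_kaehler (lambda_deform t X)"
  using assms
  by (simp add: alpha_deform_def beta_deform_def two_kaehler_deform two_kaehler_lambda_deform)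

end
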